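(* Let $\rho>0$ and $u>0$ be fixed, and let $t_{s0}=t_{s0}(u)$ be the solution in $(1,\infty)$ of $$t^{\rho}(t-1)=\frac{1}{\rho u}.$$ Then, as $k\to+\infty$ (with $k$ real and positive, not necessarily an integer), $${}_1\Psi_1(\rho,k;\rho,0;ku)=\Gamma(k)\sqrt{\frac{k}{2\pi(1+\rho)}}\left(t_{s0}-\frac{\rho}{1+\rho}\right)^{-1/2}\exp\left[k\,\psi(t_{s0})\right]\left\{1+O(k^{-1})\right\},$$ where $$\psi(t_{s0})=-\log(1-\tau_s)+\frac{\tau_s}{\rho(1-\tau_s)},\qquad \tau_s=\frac{1}{t_{s0}} .$$
   Context: For real $\rho>0$, $k>0$ and real $x$, ${}_1\Psi_1(\rho,k;\rho,0;x)=\sum_{n=1}^\infty \frac{\Gamma(k+\rho n)}{\Gamma(\rho n)}\frac{x^n}{n!}$. *)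

theory Defs
  imports "HOL-Analysis.Analysis" "HOL-Library.Landau_Symbols"
begin

text \<open>
  The series \<open>\<^sub>1\<Psi>\<^sub>1(\<rho>, k; \<rho>, 0; x)\<close>, summed over \<open>n \<ge> 1\<close>; the summation index is shifted by one.
\<close>
definition wright_psi :: "real \<Rightarrow> real \<Rightarrow> real \<Rightarrow> real" where
  "wright_psi \<rho> k x =
     (\<Sum>n. Gamma (k + \<rho> * real (Suc n)) / Gamma (\<rho> * real (Suc n)) * (x ^ Suc n / fact (Suc n)))"

definition saddle :: "real \<Rightarrow> real \<Rightarrow> real" where
  "saddle \<rho> u = (THE t. 1 < t \<and> t powr \<rho> * (t - 1) = 1 / (\<rho> * u))"

definition saddle_exponent :: "real \<Rightarrow> real \<Rightarrow> real" where
  "saddle_exponent \<rho> t =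
     (let \<tau> = 1 / t in - ln (1 - \<tau>) + \<tau> / (\<rho> * (1 - \<tau>)))"

lemma saddle_ex1:
  fixes \<rho> u :: real
  assumes "\<rho> > 0" and "u > 0"
  shows "\<exists>!t. 1 < t \<and> t powr \<rho> * (t - 1) = 1 / (\<rho> * u)"
proof -
  let ?f = "\<lambda>t::real. t powr \<rho> * (t - 1)"
  define c where "c = 1 / (\<rho> * u)"
  have c: "c > 0" using assms by (simp add: c_def)
  have mono: "?f s < ?f t" if "1 < s" "s < t" for s t
    using that assms by (intro mult_strict_mono powr_less_mono2) auto
  have "1 * c \<le> (1 + c) powr \<rho> * c"
    using c assms by (intro mult_right_mono ge_one_powr_ge_zero) auto
  then have "\<exists>t\<ge>1. t \<le> 1 + c \<and> ?f t = c"
    using c by (intro IVT') (auto intro!: continuous_intros)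
  then obtain t where t: "t \<ge> 1" "?f t = c" by blast
  moreover have "t \<noteq> 1" using t c by auto
  ultimately have "1 < t \<and> ?f t = c" by simp
  moreover have "s = t" if "1 < s \<and> ?f s = c" for s
    using mono[of s t] mono[of t s] that \<open>1 < t \<and> ?f t = c\<close>
    by (cases s t rule: linorder_cases) auto
  ultimately show ?thesis unfolding c_def by blast
qed

end

theory Submission
  imports Defs "HOL-Probability.Probability" "HOL-Complex_Analysis.Complex_Analysis"
begin

text \<open>
  Cauchy's beta integral on the line \<open>Re w = a\<close>, \<open>0 < a < 1\<close>, writes
  \<open>\<Gamma>(k + s) / (\<Gamma>(s) \<Gamma>(k + 1))\<close> as \<open>1 / (2\<pi>) \<integral> w\<^sup>-\<^sup>s (1 - w)\<^sup>-\<^sup>k\<^sup>-\<^sup>1 dy\<close>, \<open>w = a + i y\<close>.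
  Summing the exponential series under the integral turns the Wright function at \<open>k u\<close> into
  \<open>\<Gamma>(k + 1) / (2\<pi>) \<integral> exp (k \<Phi>(w)) (1 - w)\<^sup>-\<^sup>1 dy\<close> with
  \<open>\<Phi>(w) = u w\<^sup>-\<^sup>\<rho> - log (1 - w)\<close>. The saddle point of \<open>\<Phi>\<close> in \<open>(0, 1)\<close> is \<open>\<tau>\<^sub>s\<close>, and on the
  line \<open>Re w = \<tau>\<^sub>s\<close> the real part of \<open>\<Phi>\<close> is largest at \<open>\<tau>\<^sub>s\<close>, so Laplace's method applies
  without deforming the contour.
\<close>

section \<open>Laplace's method on a vertical line\<close>


text \<open>The error term O(1/k), rather than O(k powr (-1/2)), dictates the order of expansion:
  the phase is needed to third order and the amplitude to first, with remainders of order four and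
  two. Off the saddle point the phase is only known to drop like ln (1 + y^2 / b^2) / 2, so the
  integrand decays as a power of y that improves with k. This is where the thresholds on k come
  from, and why the majorants are powers of rational functions and not Gaussians.

  The beta integral is obtained from the fundamental theorem of calculus and Fubini's theorem: one
  exact derivative yields both the recurrences in the exponents and the independence of the
  abscissa. Recurrences alone leave a factor that is periodic under the shift of the exponents. To
  exclude it, growth along the shift must be known, and this comes from a second use of the same
  Laplace estimate, now with the phase -log w - log (1 - w) and the saddle point 1/2.\<close>

lemma norm_exp_minus_one_le:
  "cmod (exp z - 1) \<le> max 1 (exp (Re z)) * cmod z"
  and norm_exp_minus_one_minus_le:
  "cmod (exp z - 1 - z) \<le> max 1 (exp (Re z)) * (cmod z)\<^sup>2"
proof -
  have bound: "cmod (exp x) \<le> max 1 (exp (Re z))" if "x \<in> closed_segment 0 z" for x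
  proof -
    obtain t where "0 \<le> t" "t \<le> 1" "x = of_real t * z"
      using \<open>x \<in> closed_segment 0 z\<close> by (auto simp: in_segment scaleR_conv_of_real)
    then have "Re x \<le> max 0 (Re z)"
      by (auto simp: max_def mult_left_le_one_le mult_nonneg_nonpos)
    then show ?thesis by (auto simp: max_def)
  qed
  have "cmod (exp z - (\<Sum>i\<le>n. exp 0 * (z - 0) ^ i / fact i))
          \<le> max 1 (exp (Re z)) * cmod (z - 0) ^ Suc n / fact n" for n
    by (rule complex_Taylor[of "closed_segment 0 z" n "\<lambda>_. exp"])
       (use bound in \<open>auto intro!: derivative_eq_intros simp del: norm_exp_eq_Re\<close>)
  from this[of 0] this[of 1] show "cmod (exp z - 1) \<le> max 1 (exp (Re z)) * cmod z"
    "cmod (exp z - 1 - z) \<le> max 1 (exp (Re z)) * (cmod z)\<^sup>2"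
    by (simp_all add: power2_eq_square diff_diff_eq)
qed

text \<open>Concavity of \<open>ln\<close> between 1 and 1 + x/j, with weight j/k: equivalently (1 +
  x/k)^k increases with k. After the scaling y = z / sqrt k this bounds the integrand for every
  larger k by its weight at one fixed j.\<close>

lemma mult_ln_one_plus_div_mono:
  fixes x j k :: real
  assumes "0 \<le> x" "0 < j" "j \<le> k"
  shows "j * ln (1 + x / j) \<le> k * ln (1 + x / k)"
proof -
  have c: "concave_on {0<..} (ln :: real \<Rightarrow> real)" by (rule ln_concave)
  have "(j / k) * ln (1 + x / j) + (1 - j / k) * ln 1 \<le> ln ((j / k) * (1 + x / j) + (1 - j / k) * 1)"
    using concave_onD[OF c, of "j / k" 1 "1 + x / j"] assms
    by (simp add: divide_simps add_pos_nonneg algebra_simps)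
  also have "(j / k) * (1 + x / j) + (1 - j / k) * 1 = 1 + x / k"
    using assms by (simp add: field_simps)
  finally show ?thesis using assms by (simp add: field_simps)
qed

lemma integrable_inverse_one_plus_square: "integrable lborel (\<lambda>x::real. inverse (1 + x\<^sup>2))"
  using integrable_inverse_1_plus_square by (simp add: set_integrable_def)

lemma integrable_inverse_one_plus_square_scaled:
  assumes "b > 0"
  shows "integrable lborel (\<lambda>x::real. inverse (1 + x\<^sup>2 / b\<^sup>2))"
  using lborel_integrable_real_affine[OF integrable_inverse_one_plus_square, of "1 / b" 0] assms
  by (simp add: power_divide)

lemma has_bochner_integral_exp_neg_half_square:
  assumes "V > 0"
  shows "has_bochner_integral lborel (\<lambda>z::real. exp (- V * z\<^sup>2 / 2)) (sqrt (2 * pi / V))"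
proof -
  define s where "s = 1 / sqrt V"
  have s: "s > 0" "s\<^sup>2 = 1 / V" using assms by (auto simp: s_def power_divide)
  have "has_bochner_integral lborel (\<lambda>x. normal_density 0 s x * sqrt (2 * pi * s\<^sup>2)) (1 * sqrt (2 * pi * s\<^sup>2))"
    using normal_moment_even[OF s(1), of 0 0] by (intro has_bochner_integral_mult_left) simp
  also have "(\<lambda>x. normal_density 0 s x * sqrt (2 * pi * s\<^sup>2)) = (\<lambda>z::real. exp (- V * z\<^sup>2 / 2))"
    using assms s by (auto simp: normal_density_def fun_eq_iff)
  finally show ?thesis using s by simp
qed

lemma integrable_exp_neg_half_square_power:
  assumes "V > 0"
  shows "integrable lborel (\<lambda>z::real. exp (- V * z\<^sup>2 / 2) * z ^ n)"
proof -
  define s where "s = 1 / sqrt V"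
  have s: "s > 0" "s\<^sup>2 = 1 / V" using assms by (auto simp: s_def power_divide)
  have "integrable lborel (\<lambda>x. sqrt (2 * pi * s\<^sup>2) * (normal_density 0 s x * x ^ n))"
    using integrable_normal_moment[OF s(1), of 0 n] by (intro integrable_mult_right) simp
  also have "(\<lambda>x. sqrt (2 * pi * s\<^sup>2) * (normal_density 0 s x * x ^ n)) = (\<lambda>z::real. exp (- V * z\<^sup>2 / 2) * z ^ n)"
    using assms s by (auto simp: normal_density_def fun_eq_iff)
  finally show ?thesis .
qed

lemma integral_odd_eq_0:
  fixes f :: "real \<Rightarrow> 'a :: {banach, second_countable_topology}"
  assumes "\<And>x. f (- x) = - f x"
  shows "integral\<^sup>L lborel f = 0"
proof -
  have "integral\<^sup>L lborel f = (\<integral>x. f (- x) \<partial>lborel)"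
    using lborel_integral_real_affine[of "-1" f 0] by simp
  also have "\<dots> = - integral\<^sup>L lborel f" by (simp add: assms)
  finally have "2 *\<^sub>R integral\<^sup>L lborel f = 0"
    unfolding scaleR_2 by (metis add.right_inverse)
  then show ?thesis by simp
qed

text \<open>
  \<open>W\<close> dominates both \<open>exp (k p)\<close> and, because \<open>V b\<^sup>2 \<ge> 1\<close>, the Gaussian \<open>exp (- k V y\<^sup>2 / 2)\<close>; a
  single weight therefore controls the error near the saddle and in the tails.
\<close>
lemma laplace_pointwise:
  fixes p q :: complex and k y V b B \<delta> C1 C3 D1 D3 W :: real
  assumes k: "k > 0" and V: "V * b\<^sup>2 \<ge> 1" and b: "b > 0" and \<delta>: "\<delta> > 0"
    and p: "\<bar>y\<bar> < \<delta> \<Longrightarrow> cmod (p + of_real (V * y\<^sup>2 / 2) - c * of_real y ^ 3) \<le> C1 * y ^ 4"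
    and q: "\<bar>y\<bar> < \<delta> \<Longrightarrow> cmod (q - q0 - q1 * of_real y) \<le> C3 * y\<^sup>2"
    and C: "C1 \<ge> 0" "C3 \<ge> 0" "B \<ge> 0"
    and Re: "Re p \<le> - ln (1 + y\<^sup>2 / b\<^sup>2) / 2" and B: "cmod q \<le> B"
    and W: "exp (- k * ln (1 + y\<^sup>2 / b\<^sup>2) / 2) \<le> W"
  defines "K \<equiv> C3 + (cmod c + C1 * \<delta>) * cmod q1 + cmod q0 * (cmod c + C1 * \<delta>)\<^sup>2 + cmod q0 * C1
             + (B + cmod q0) / \<delta>\<^sup>2 + cmod q1 / \<delta> + cmod q0 * cmod c / \<delta>"
  shows "cmod (exp (of_real k * p) * q
      - exp (- of_real (k * V * y\<^sup>2 / 2)) * (q0 + q1 * of_real y + of_real k * q0 * c * of_real y ^ 3))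
      \<le> K * W * (y\<^sup>2 + k * y ^ 4 + k\<^sup>2 * y ^ 6)"
proof -
  define A where "A = of_real k * p"
  define A0 :: complex where "A0 = - of_real (k * V * y\<^sup>2 / 2)"
  define R where "R = p + of_real (V * y\<^sup>2 / 2) - c * of_real y ^ 3"
  define D where "D = of_real k * (c * of_real y ^ 3 + R)"
  \<comment> \<open>At the scale y = z / sqrt k each of the three monomials equals 1/k times a power
    of z; \<open>Q\<close> thus collects exactly the admissible error terms.\<close>
  define Q where "Q = y\<^sup>2 + k * y ^ 4 + k\<^sup>2 * y ^ 6"
  have AD: "A = A0 + D" by (simp add: A_def A0_def D_def R_def algebra_simps)
  have Q: "y\<^sup>2 \<le> Q" "k * y ^ 4 \<le> Q" "k\<^sup>2 * y ^ 6 \<le> Q" "Q \<ge> 0" using k by (auto simp: Q_def)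
  have W0: "W \<ge> 0" using W by (meson exp_ge_zero order_trans)
  have eA: "cmod (exp A) \<le> W"
  proof -
    have "k * Re p \<le> k * (- ln (1 + y\<^sup>2 / b\<^sup>2) / 2)" using Re k by (intro mult_left_mono) auto
    then have "exp (k * Re p) \<le> exp (- k * ln (1 + y\<^sup>2 / b\<^sup>2) / 2)" by simp
    then have "cmod (exp A) \<le> exp (- k * ln (1 + y\<^sup>2 / b\<^sup>2) / 2)" by (simp add: A_def)
    then show ?thesis using W by (rule order_trans)
  qed
  have eA0: "cmod (exp A0) \<le> W"
  proof -
    have "1 / b\<^sup>2 \<le> V" using V b by (simp add: field_simps)
    then have "y\<^sup>2 * (1 / b\<^sup>2) \<le> y\<^sup>2 * V" by (intro mult_left_mono) auto
    moreover have "ln (1 + y\<^sup>2 / b\<^sup>2) \<le> y\<^sup>2 / b\<^sup>2" by (intro ln_add_one_self_le_self) auto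
    ultimately have "ln (1 + y\<^sup>2 / b\<^sup>2) \<le> V * y\<^sup>2" by (simp add: mult.commute)
    then have "k * ln (1 + y\<^sup>2 / b\<^sup>2) \<le> k * (V * y\<^sup>2)" using k by (intro mult_left_mono) auto
    then have "exp (- (k * V * y\<^sup>2 / 2)) \<le> exp (- k * ln (1 + y\<^sup>2 / b\<^sup>2) / 2)" by simp
    then have "cmod (exp A0) \<le> exp (- k * ln (1 + y\<^sup>2 / b\<^sup>2) / 2)" by (simp add: A0_def mult.assoc)
    then show ?thesis using W by (rule order_trans)
  qed
  let ?M = "exp A0 * (q0 + q1 * of_real y + of_real k * q0 * c * of_real y ^ 3)"
  have "cmod (exp A * q - ?M) \<le> K * W * Q"
  proof (cases "\<bar>y\<bar> < \<delta>")
    case True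
    note p = p[OF True] and q = q[OF True]
    have y4: "y ^ 4 = \<bar>y\<bar> ^ 3 * \<bar>y\<bar>" "y ^ 6 = (\<bar>y\<bar> ^ 3)\<^sup>2" "y ^ 4 = \<bar>y\<bar> ^ 4"
      by (simp_all add: power_mult flip: power_Suc2 power_mult)
    have R: "cmod R \<le> C1 * y ^ 4" using p by (simp add: R_def)
    \<comment> \<open>One factor |y| < \<delta> is given away so that the quartic remainder joins
      the cubic term in a single cubic bound for \<open>D\<close>.\<close>
    have R': "cmod R \<le> C1 * \<delta> * \<bar>y\<bar> ^ 3"
    proof -
      have "C1 * y ^ 4 \<le> C1 * (\<bar>y\<bar> ^ 3 * \<delta>)"
        unfolding y4(1) using True C by (intro mult_left_mono) auto
      then show ?thesis using R by (simp add: mult_ac)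
    qed
    define L where "L = cmod c + C1 * \<delta>"
    have L: "L \<ge> 0" using C \<delta> by (simp add: L_def)
    have D: "cmod D \<le> k * L * \<bar>y\<bar> ^ 3"
    proof -
      have "cmod D = k * cmod (c * of_real y ^ 3 + R)" using k by (simp add: D_def norm_mult)
      also have "cmod (c * of_real y ^ 3 + R) \<le> cmod c * \<bar>y\<bar> ^ 3 + C1 * \<delta> * \<bar>y\<bar> ^ 3"
        using R' by (intro order.trans[OF norm_triangle_ineq] add_mono) (auto simp: norm_mult norm_power)
      finally show ?thesis using k by (simp add: L_def algebra_simps)
    qed
    \<comment> \<open>Since |exp A0| * exp (Re D) = |exp A|, the factor max 1 (exp (Re D)) of the
      Taylor remainders only ever produces the larger of two quantities already below
      \<open>W\<close>. No smallness of \<open>D\<close> is required, although k |y|^3 need not be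
      bounded.\<close>
    have max: "cmod (exp A0) * max 1 (exp (Re D)) \<le> W"
    proof -
      have "cmod (exp A0) * max 1 (exp (Re D)) = max (cmod (exp A0)) (cmod (exp A))"
        by (auto simp: max_mult_distrib_left AD exp_add norm_mult)
      then show ?thesis using eA eA0 by simp
    qed
    have T1: "cmod (exp A * (q - q0 - q1 * of_real y)) \<le> W * (C3 * Q)"
      unfolding norm_mult using eA q C Q W0
      by (intro mult_mono order.trans[OF q] mult_left_mono) auto
    have T2: "cmod (exp A0 * (exp D - 1) * (q1 * of_real y)) \<le> W * (L * cmod q1 * Q)"
    proof -
      have "cmod (exp A0 * (exp D - 1)) \<le> cmod (exp A0) * (max 1 (exp (Re D)) * cmod D)"
        unfolding norm_mult by (intro mult_left_mono norm_exp_minus_one_le) auto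
      also have "\<dots> \<le> W * (k * L * \<bar>y\<bar> ^ 3)"
        unfolding mult.assoc[symmetric, of "cmod (exp A0)"] using max D W0 by (intro mult_mono) auto
      finally have "cmod (exp A0 * (exp D - 1) * (q1 * of_real y))
          \<le> W * (k * L * \<bar>y\<bar> ^ 3) * (cmod q1 * \<bar>y\<bar>)"
        unfolding norm_mult[of "exp A0 * (exp D - 1)"]
        by (intro mult_mono) (use W0 L k in \<open>auto simp: norm_mult\<close>)
      also have "\<dots> = W * (L * cmod q1 * (k * y ^ 4))" unfolding y4(1) by (simp add: mult_ac)
      also have "\<dots> \<le> W * (L * cmod q1 * Q)" using Q W0 L by (intro mult_left_mono) auto
      finally show ?thesis .
    qed
    have T3: "cmod (q0 * (exp A0 * (exp D - 1 - D))) \<le> W * (cmod q0 * L\<^sup>2 * Q)"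
    proof -
      have "cmod (exp A0 * (exp D - 1 - D)) \<le> cmod (exp A0) * (max 1 (exp (Re D)) * (cmod D)\<^sup>2)"
        unfolding norm_mult by (intro mult_left_mono norm_exp_minus_one_minus_le) auto
      also have "\<dots> = (cmod (exp A0) * max 1 (exp (Re D))) * (cmod D)\<^sup>2" by simp
      also have "\<dots> \<le> W * (k * L * \<bar>y\<bar> ^ 3)\<^sup>2"
        using max D W0 by (intro mult_mono power_mono) auto
      also have "(k * L * \<bar>y\<bar> ^ 3)\<^sup>2 = L\<^sup>2 * (k\<^sup>2 * y ^ 6)" unfolding y4(2) by (simp add: power_mult_distrib)
      also have "W * (L\<^sup>2 * (k\<^sup>2 * y ^ 6)) \<le> W * (L\<^sup>2 * Q)" using W0 Q by (intro mult_left_mono) auto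
      finally have "cmod q0 * cmod (exp A0 * (exp D - 1 - D)) \<le> cmod q0 * (W * (L\<^sup>2 * Q))"
        by (intro mult_left_mono) auto
      then show ?thesis by (simp add: norm_mult mult_ac)
    qed
    have T4: "cmod (q0 * (exp A0 * (of_real k * R))) \<le> W * (cmod q0 * C1 * Q)"
    proof -
      have "cmod (exp A0 * (of_real k * R)) \<le> W * (k * (C1 * y ^ 4))"
        unfolding norm_mult using eA0 R k W0 C by (intro mult_mono) auto
      also have "k * (C1 * y ^ 4) = C1 * (k * y ^ 4)" by simp
      also have "W * (C1 * (k * y ^ 4)) \<le> W * (C1 * Q)" using W0 C Q by (intro mult_left_mono) auto
      finally have "cmod q0 * cmod (exp A0 * (of_real k * R)) \<le> cmod q0 * (W * (C1 * Q))"
        by (intro mult_left_mono) auto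
      then show ?thesis by (simp add: norm_mult mult_ac)
    qed
    \<comment> \<open>Four sources of error: the remainder of q, the first-order remainder of exp D
      against q1 y, its second-order remainder against q0, and the quartic part of the phase, which
      is present in \<open>D\<close> but not in \<open>?M\<close>.\<close>
    have "exp A * q - ?M = exp A * (q - q0 - q1 * of_real y) + exp A0 * (exp D - 1) * (q1 * of_real y)
        + q0 * (exp A0 * (exp D - 1 - D)) + q0 * (exp A0 * (of_real k * R))"
      by (simp add: AD exp_add D_def algebra_simps)
    also have "cmod \<dots> \<le> W * (C3 * Q) + W * (L * cmod q1 * Q) + W * (cmod q0 * L\<^sup>2 * Q) + W * (cmod q0 * C1 * Q)"
      using T1 T2 T3 T4 by (intro order.trans[OF norm_triangle_ineq] add_mono) auto
    also have "\<dots> = (C3 + L * cmod q1 + cmod q0 * L\<^sup>2 + cmod q0 * C1) * (W * Q)"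
      by (simp add: algebra_simps)
    also have "\<dots> \<le> K * (W * Q)"
      using W0 Q C \<delta> by (intro mult_right_mono) (auto simp: K_def L_def)
    finally show ?thesis by (simp add: mult.assoc)
  next
    case False
    \<comment> \<open>Far from the saddle point nothing is expanded. Both terms are small by the
      weight \<open>W\<close> alone, and factors |y| / \<delta> >= 1 raise low powers of y to
      monomials of \<open>Q\<close>; hence the negative powers of \<delta> in
      \<open>K\<close>.\<close>
    then have ge: "\<delta> \<le> \<bar>y\<bar>" by simp
    have one: "1 \<le> Q / \<delta>\<^sup>2"
    proof -
      have "\<delta>\<^sup>2 \<le> \<bar>y\<bar>\<^sup>2" using ge \<delta> by (intro power_mono) auto
      then show ?thesis using Q \<delta> by (simp add: field_simps)
    qed
    have lin: "\<bar>y\<bar> \<le> Q / \<delta>"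
    proof -
      have "\<bar>y\<bar> * \<delta> \<le> \<bar>y\<bar> * \<bar>y\<bar>" using ge by (intro mult_left_mono) auto
      also have "\<dots> = y\<^sup>2" by (simp add: power2_eq_square)
      finally show ?thesis using Q \<delta> by (simp add: field_simps)
    qed
    have cub: "k * \<bar>y\<bar> ^ 3 \<le> Q / \<delta>"
    proof -
      have "k * \<bar>y\<bar> ^ 3 * \<delta> \<le> k * \<bar>y\<bar> ^ 3 * \<bar>y\<bar>" using ge k by (intro mult_left_mono) auto
      also have "\<dots> = k * y ^ 4" by (simp flip: power_Suc2)
      finally show ?thesis using Q \<delta> by (simp add: field_simps)
    qed
    have "cmod (exp A * q) \<le> W * (B * (Q / \<delta>\<^sup>2))"
    proof -
      have "cmod (exp A * q) \<le> W * (B * 1)"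
        unfolding norm_mult using eA B W0 by (intro mult_mono) auto
      also have "\<dots> \<le> W * (B * (Q / \<delta>\<^sup>2))" using one W0 C by (intro mult_left_mono) auto
      finally show ?thesis .
    qed
    moreover have "cmod ?M \<le> W * (cmod q0 * (Q / \<delta>\<^sup>2) + cmod q1 * (Q / \<delta>) + cmod q0 * cmod c * (Q / \<delta>))"
    proof -
      have "cmod (q0 + q1 * of_real y + of_real k * q0 * c * of_real y ^ 3)
          \<le> cmod q0 * 1 + cmod q1 * \<bar>y\<bar> + cmod q0 * cmod c * (k * \<bar>y\<bar> ^ 3)"
        using k by (intro order.trans[OF norm_triangle_ineq] add_mono) (auto simp: norm_mult norm_power)
      also have "\<dots> \<le> cmod q0 * (Q / \<delta>\<^sup>2) + cmod q1 * (Q / \<delta>) + cmod q0 * cmod c * (Q / \<delta>)"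
        using one lin cub by (intro add_mono mult_left_mono) auto
      finally show ?thesis unfolding norm_mult[of "exp A0"] using eA0 W0 by (intro mult_mono) auto
    qed
    ultimately have "cmod (exp A * q - ?M) \<le> W * (B * (Q / \<delta>\<^sup>2)) +
        W * (cmod q0 * (Q / \<delta>\<^sup>2) + cmod q1 * (Q / \<delta>) + cmod q0 * cmod c * (Q / \<delta>))"
      by (intro order.trans[OF norm_triangle_ineq4] add_mono)
    also have "\<dots> = ((B + cmod q0) / \<delta>\<^sup>2 + cmod q1 / \<delta> + cmod q0 * cmod c / \<delta>) * (W * Q)"
      by (simp add: algebra_simps add_divide_distrib)
    also have "\<dots> \<le> K * (W * Q)"
      using W0 Q C \<delta> by (intro mult_right_mono) (auto simp: K_def)
    finally show ?thesis by (simp add: mult.assoc)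
  qed
  then show ?thesis by (simp add: A_def A0_def Q_def)
qed

text \<open>Substituting y = z / sqrt k makes the Gaussian independent of k and turns the pointwise
  error into 1/k times an integrable function. The bound k >= 8 guarantees at least four inverse
  powers of 1 + z^2 / (8 b^2) in the weight.\<close>

lemma laplace_line:
  fixes p q :: "real \<Rightarrow> complex" and V b B \<delta> C1 C3 :: real
  assumes V: "V * b\<^sup>2 \<ge> 1" and b: "b > 0" and \<delta>: "\<delta> > 0"
    and p: "\<And>y. \<bar>y\<bar> < \<delta> \<Longrightarrow> cmod (p y + of_real (V * y\<^sup>2 / 2) - c * of_real y ^ 3) \<le> C1 * y ^ 4"
    and q: "\<And>y. \<bar>y\<bar> < \<delta> \<Longrightarrow> cmod (q y - q0 - q1 * of_real y) \<le> C3 * y\<^sup>2"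
    and C: "C1 \<ge> 0" "C3 \<ge> 0"
    and Re: "\<And>y. Re (p y) \<le> - ln (1 + y\<^sup>2 / b\<^sup>2) / 2" and B: "\<And>y. cmod (q y) \<le> B"
    and meas [measurable]: "p \<in> borel_measurable borel" "q \<in> borel_measurable borel"
  shows "\<exists>C. \<forall>k\<ge>8. cmod (of_real (sqrt k) * (\<integral>y. exp (of_real k * p y) * q y \<partial>lborel)
           - q0 * of_real (sqrt (2 * pi / V))) \<le> C / k"
proof -
  have Vpos: "V > 0"
    using V b by (metis less_le_trans mult_pos_pos not_less zero_less_one mult_nonpos_nonneg zero_le_power2)
  have B0: "B \<ge> 0" using B[of 0] norm_ge_zero order_trans by blast
  define K where "K = C3 + (cmod c + C1 * \<delta>) * cmod q1 + cmod q0 * (cmod c + C1 * \<delta>)\<^sup>2 + cmod q0 * C1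
             + (B + cmod q0) / \<delta>\<^sup>2 + cmod q1 / \<delta> + cmod q0 * cmod c / \<delta>"
  define r where "r = (\<lambda>z::real. 1 + z\<^sup>2 / (8 * b\<^sup>2))"
  \<comment> \<open>Majorant in the variable \<open>z = y * sqrt k\<close>, independent of \<open>k \<ge> 8\<close>; the exponent 4 makes \<open>z ^ 6\<close> integrable.\<close>
  define H where "H = (\<lambda>z::real. inverse (r z) ^ 4 * (z\<^sup>2 + z ^ 4 + z ^ 6))"
  have r: "r z \<ge> 1" for z by (simp add: r_def)
  have H_int: "integrable lborel H"
  proof (rule Bochner_Integration.integrable_bound)
    have "sqrt (8 * b\<^sup>2) > 0" using b by simp
    from integrable_inverse_one_plus_square_scaled[OF this]
    show "integrable lborel (\<lambda>z. (8 * b\<^sup>2 + (8 * b\<^sup>2)\<^sup>2 + (8 * b\<^sup>2) ^ 3) * inverse (r z))"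
      by (intro integrable_mult_right) (simp add: r_def)
    show "H \<in> borel_measurable lborel" unfolding H_def r_def by measurable
    have "norm (H z) \<le> norm ((8 * b\<^sup>2 + (8 * b\<^sup>2)\<^sup>2 + (8 * b\<^sup>2) ^ 3) * inverse (r z))" for z
    proof -
      \<comment> \<open>The polynomial of degree six consumes at most three of the four inverse
        powers of \<open>r\<close>; the remaining one is integrable.\<close>
      have z: "z\<^sup>2 \<le> 8 * b\<^sup>2 * r z" using b by (simp add: r_def field_simps)
      have "z\<^sup>2 + z ^ 4 + z ^ 6 = z\<^sup>2 + (z\<^sup>2)\<^sup>2 + (z\<^sup>2) ^ 3" by (simp flip: power_mult)
      also have "\<dots> \<le> 8 * b\<^sup>2 * r z + (8 * b\<^sup>2 * r z)\<^sup>2 + (8 * b\<^sup>2 * r z) ^ 3"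
        using z by (intro add_mono power_mono) auto
      also have "\<dots> = 8 * b\<^sup>2 * r z ^ 1 + (8 * b\<^sup>2)\<^sup>2 * r z ^ 2 + (8 * b\<^sup>2) ^ 3 * r z ^ 3"
        by (simp add: power_mult_distrib)
      also have "\<dots> \<le> 8 * b\<^sup>2 * r z ^ 3 + (8 * b\<^sup>2)\<^sup>2 * r z ^ 3 + (8 * b\<^sup>2) ^ 3 * r z ^ 3"
        using r[of z] by (intro add_mono mult_left_mono power_increasing) auto
      also have "\<dots> = (8 * b\<^sup>2 + (8 * b\<^sup>2)\<^sup>2 + (8 * b\<^sup>2) ^ 3) * r z ^ 3" by (simp add: distrib_right)
      finally have "H z \<le> inverse (r z) ^ 4 * ((8 * b\<^sup>2 + (8 * b\<^sup>2)\<^sup>2 + (8 * b\<^sup>2) ^ 3) * r z ^ 3)"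
        unfolding H_def using r[of z] by (intro mult_left_mono) auto
      also have "\<dots> = (8 * b\<^sup>2 + (8 * b\<^sup>2)\<^sup>2 + (8 * b\<^sup>2) ^ 3) * inverse (r z)"
        using r[of z] by (simp add: field_simps eval_nat_numeral)
      finally have "H z \<le> (8 * b\<^sup>2 + (8 * b\<^sup>2)\<^sup>2 + (8 * b\<^sup>2) ^ 3) * inverse (r z)" .
      moreover have "H z \<ge> 0" using r[of z] by (auto simp: H_def)
      ultimately show ?thesis by simp
    qed
    then show "AE z in lborel. norm (H z) \<le> norm ((8 * b\<^sup>2 + (8 * b\<^sup>2)\<^sup>2 + (8 * b\<^sup>2) ^ 3) * inverse (r z))"
      by simp
  qed
  have "cmod (of_real (sqrt k) * (\<integral>y. exp (of_real k * p y) * q y \<partial>lborel)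
           - q0 * of_real (sqrt (2 * pi / V))) \<le> (K * integral\<^sup>L lborel H) / k" if k: "k \<ge> 8" for k :: real
  proof -
    define s where "s = inverse (sqrt k)"
    have s: "s > 0" "s\<^sup>2 = 1 / k" using k by (auto simp: s_def field_simps)
    have s': "s ^ 4 = 1 / k\<^sup>2" "s ^ 6 = 1 / k ^ 3" "s ^ 3 = s / k"
      using s(2) power_mult[of s 2 2] power_mult[of s 2 3] power_Suc2[of s 2]
      by (simp_all add: power_divide)
    define P where "P = (\<lambda>z. exp (of_real k * p (s * z)) * q (s * z))"
    define M0 :: "real \<Rightarrow> complex" where "M0 = (\<lambda>z. of_real (exp (- V * z\<^sup>2 / 2)) * q0)"
    \<comment> \<open>The terms of relative order \<open>k powr (- 1 / 2)\<close> are odd and integrate to 0.\<close>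
    define M1 :: "real \<Rightarrow> complex" where
      "M1 = (\<lambda>z. of_real (exp (- V * z\<^sup>2 / 2) * z ^ 1) * (s * q1) + of_real (exp (- V * z\<^sup>2 / 2) * z ^ 3) * (s * q0 * c))"
    have diff: "cmod (P z - (M0 z + M1 z)) \<le> K / k * H z" for z
    proof -
      have "k * ln (1 + (s * z)\<^sup>2 / b\<^sup>2) \<ge> 8 * ln (r z)"
        using mult_ln_one_plus_div_mono[of "z\<^sup>2 / b\<^sup>2" 8 k] k
        by (simp add: r_def power_mult_distrib s mult.commute)
      then have "exp (- k * ln (1 + (s * z)\<^sup>2 / b\<^sup>2) / 2) \<le> exp (- (of_nat 4 * ln (r z)))" by simp
      also have "\<dots> = inverse (r z) ^ 4"
        using r[of z] by (simp only: exp_minus exp_of_nat_mult) (simp add: power_inverse)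
      finally have W: "exp (- k * ln (1 + (s * z)\<^sup>2 / b\<^sup>2) / 2) \<le> inverse (r z) ^ 4" .
      have "cmod (exp (of_real k * p (s * z)) * q (s * z)
          - exp (- of_real (k * V * (s * z)\<^sup>2 / 2)) *
            (q0 + q1 * of_real (s * z) + of_real k * q0 * c * of_real (s * z) ^ 3))
          \<le> K * inverse (r z) ^ 4 * ((s * z)\<^sup>2 + k * (s * z) ^ 4 + k\<^sup>2 * (s * z) ^ 6)"
        unfolding K_def using k
        by (intro laplace_pointwise[OF _ V b \<delta> p q C B0 Re B W]) auto
      also have "(s * z)\<^sup>2 + k * (s * z) ^ 4 + k\<^sup>2 * (s * z) ^ 6 = (z\<^sup>2 + z ^ 4 + z ^ 6) / k"
        unfolding power_mult_distrib s s' using k by (simp add: field_simps eval_nat_numeral)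
      also have "exp (- of_real (k * V * (s * z)\<^sup>2 / 2)) *
            (q0 + q1 * of_real (s * z) + of_real k * q0 * c * of_real (s * z) ^ 3) = M0 z + M1 z"
      proof -
        have "k * V * (s * z)\<^sup>2 / 2 = V * z\<^sup>2 / 2" using k by (simp add: power_mult_distrib s)
        then have 1: "exp (- of_real (k * V * (s * z)\<^sup>2 / 2)) = (of_real (exp (- V * z\<^sup>2 / 2)) :: complex)"
          by (metis exp_of_real minus_divide_left mult_minus_left of_real_minus)
        have "k * (s * z) ^ 3 = s * z ^ 3" using k by (simp add: power_mult_distrib s')
        then have "of_real k * of_real (s * z) ^ 3 = (of_real (s * z ^ 3) :: complex)"
          by (simp flip: of_real_power of_real_mult)
        then have 2: "of_real k * q0 * c * of_real (s * z) ^ 3 = q0 * c * of_real (s * z ^ 3)"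
          by (metis mult.assoc mult.commute)
        show ?thesis
          unfolding 1 2 M0_def M1_def by (simp add: algebra_simps)
      qed
      finally show ?thesis by (simp add: P_def H_def)
    qed
    have M0: "has_bochner_integral lborel M0 (of_real (sqrt (2 * pi / V)) * q0)"
      unfolding M0_def
      by (intro has_bochner_integral_mult_left has_bochner_integral_of_real has_bochner_integral_exp_neg_half_square Vpos)
    have M1: "integrable lborel M1"
      unfolding M1_def
      by (intro Bochner_Integration.integrable_add integrable_mult_left integrable_of_real
            integrable_exp_neg_half_square_power Vpos)
    have M1': "integral\<^sup>L lborel M1 = 0"
      by (rule integral_odd_eq_0) (simp add: M1_def)
    have P_meas: "P \<in> borel_measurable lborel" unfolding P_def by measurable
    have D: "integrable lborel (\<lambda>z. P z - (M0 z + M1 z))"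
    proof (rule Bochner_Integration.integrable_bound)
      show "integrable lborel (\<lambda>z. K / k * H z)" using H_int by (intro integrable_mult_right)
      show "(\<lambda>z. P z - (M0 z + M1 z)) \<in> borel_measurable lborel"
        using P_meas M0 M1 by (auto simp: has_bochner_integral_iff)
      show "AE z in lborel. norm (P z - (M0 z + M1 z)) \<le> norm (K / k * H z)"
        unfolding real_norm_def by (intro AE_I2 order_trans[OF diff abs_ge_self])
    qed
    have M: "integrable lborel (\<lambda>z. M0 z + M1 z)"
      using M0 M1 by (auto simp: has_bochner_integral_iff)
    \<comment> \<open>Integrability has been established for the difference and for the Gaussian
      part, so the integral of \<open>P\<close> is recovered from their sum.\<close>
    have "integral\<^sup>L lborel P = (\<integral>z. (P z - (M0 z + M1 z)) + (M0 z + M1 z) \<partial>lborel)" by simp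
    also have "\<dots> = (\<integral>z. P z - (M0 z + M1 z) \<partial>lborel) + of_real (sqrt (2 * pi / V)) * q0"
      using M0 M1 M1' D M by (subst Bochner_Integration.integral_add) (auto simp: has_bochner_integral_iff)
    finally have "integral\<^sup>L lborel P - q0 * of_real (sqrt (2 * pi / V)) = (\<integral>z. P z - (M0 z + M1 z) \<partial>lborel)"
      by (simp add: mult.commute)
    moreover have "cmod (\<integral>z. P z - (M0 z + M1 z) \<partial>lborel) \<le> (\<integral>z. K / k * H z \<partial>lborel)"
      by (rule Bochner_Integration.integral_norm_bound_integral) (use D H_int diff in auto)
    moreover have "of_real (sqrt k) * (\<integral>y. exp (of_real k * p y) * q y \<partial>lborel) = integral\<^sup>L lborel P"
      using s(1) k
      by (subst lborel_integral_real_affine[of s _ 0]) (auto simp: P_def scaleR_conv_of_real s_def field_simps)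
    ultimately show ?thesis by simp
  qed
  then show ?thesis by blast
qed

section \<open>Laplace's method for a holomorphic phase on a vertical line\<close>

lemma holomorphic_Taylor_bound:
  assumes "f holomorphic_on S" "open S" "z0 \<in> S"
  obtains C \<delta> where "C \<ge> 0" "\<delta> > 0"
    "\<And>z. cmod (z - z0) < \<delta> \<Longrightarrow>
       cmod (f z - (\<Sum>i\<le>n. (deriv ^^ i) f z0 * (z - z0) ^ i / fact i)) \<le> C * cmod (z - z0) ^ Suc n"
proof -
  obtain \<delta> where \<delta>: "\<delta> > 0" "cball z0 \<delta> \<subseteq> S" using assms open_contains_cball by blast
  define F where "F = (deriv ^^ Suc n) f"
  have "continuous_on (cball z0 \<delta>) F"
    unfolding F_def using assms \<delta>
    by (intro holomorphic_on_imp_continuous_on holomorphic_on_subset[OF holomorphic_higher_deriv, of f S]) auto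
  then have "bounded (F ` cball z0 \<delta>)"
    by (intro compact_imp_bounded compact_continuous_image) auto
  then obtain C where C: "\<And>z. z \<in> cball z0 \<delta> \<Longrightarrow> cmod (F z) \<le> C"
    by (metis bounded_iff imageI)
  have "cmod (f z - (\<Sum>i\<le>n. (deriv ^^ i) f z0 * (z - z0) ^ i / fact i)) \<le> C / fact n * cmod (z - z0) ^ Suc n"
    if "cmod (z - z0) < \<delta>" for z
  proof -
    have "cmod ((deriv ^^ 0) f z - (\<Sum>i\<le>n. (deriv ^^ i) f z0 * (z - z0) ^ i / fact i))
        \<le> C * cmod (z - z0) ^ Suc n / fact n"
    proof (rule complex_Taylor[of "cball z0 \<delta>" n "\<lambda>i. (deriv ^^ i) f"])
      show "((deriv ^^ i) f has_field_derivative (deriv ^^ Suc i) f x) (at x within cball z0 \<delta>)"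
        if "x \<in> cball z0 \<delta>" for i x
        using assms \<delta> that by (intro has_field_derivative_at_within[OF has_field_derivative_higher_deriv]) auto
    qed (use C[unfolded F_def] \<delta> that in \<open>simp_all add: dist_norm norm_minus_commute del: funpow.simps\<close>)
    then show ?thesis by simp
  qed
  moreover have "C \<ge> 0" using C[of z0] \<delta> norm_ge_zero order_trans by (metis centre_in_cball less_imp_le)
  ultimately show ?thesis using that[of "C / fact n" \<delta>] \<delta> by simp
qed

text \<open>Along the line w - \<tau> = i y, so a second derivative V > 0 of the phase becomes the
  decay -V y^2 / 2. The phase is kept general because the estimate serves twice: for the Wright
  function, and for the growth of the beta integral when both exponents are raised together.\<close>

lemma laplace_vertical:
  fixes \<Phi> g :: "complex \<Rightarrow> complex" and \<tau> V b B :: real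
  assumes S: "open S" "\<And>y. Complex \<tau> y \<in> S"
    and hol: "\<Phi> holomorphic_on S" "g holomorphic_on S"
    and d1: "deriv \<Phi> (of_real \<tau>) = 0" and d2: "deriv (deriv \<Phi>) (of_real \<tau>) = of_real V"
    and V: "V * b\<^sup>2 \<ge> 1" and b: "b > 0"
    and Re: "\<And>y. Re (\<Phi> (Complex \<tau> y)) \<le> Re (\<Phi> (of_real \<tau>)) - ln (1 + y\<^sup>2 / b\<^sup>2) / 2"
    and B: "\<And>y. cmod (g (Complex \<tau> y)) \<le> B"
  shows "\<exists>C. \<forall>k\<ge>8. cmod (of_real (sqrt k) *
           (\<integral>y. exp (of_real k * (\<Phi> (Complex \<tau> y) - \<Phi> (of_real \<tau>))) * g (Complex \<tau> y) \<partial>lborel)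
           - g (of_real \<tau>) * of_real (sqrt (2 * pi / V))) \<le> C / k"
proof -
  have \<tau>: "of_real \<tau> \<in> S" using S(2)[of 0] by (simp add: complex_of_real_def)
  have line: "Complex \<tau> y - of_real \<tau> = \<i> * of_real y" for y by (simp add: complex_eq_iff)
  obtain C1 \<delta>1 where 1: "C1 \<ge> 0" "\<delta>1 > 0"
    "\<And>z. cmod (z - of_real \<tau>) < \<delta>1 \<Longrightarrow>
       cmod (\<Phi> z - (\<Sum>i\<le>3. (deriv ^^ i) \<Phi> (of_real \<tau>) * (z - of_real \<tau>) ^ i / fact i))
         \<le> C1 * cmod (z - of_real \<tau>) ^ Suc 3"
    by (rule holomorphic_Taylor_bound[OF hol(1) S(1) \<tau>, of 3]) (rule that)
  obtain C3 \<delta>3 where 3: "C3 \<ge> 0" "\<delta>3 > 0"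
    "\<And>z. cmod (z - of_real \<tau>) < \<delta>3 \<Longrightarrow>
       cmod (g z - (\<Sum>i\<le>1. (deriv ^^ i) g (of_real \<tau>) * (z - of_real \<tau>) ^ i / fact i))
         \<le> C3 * cmod (z - of_real \<tau>) ^ Suc 1"
    by (rule holomorphic_Taylor_bound[OF hol(2) S(1) \<tau>, of 1]) (rule that)
  \<comment> \<open>The cubic Taylor coefficient along the line: (i y)^3 = -i y^3, divided by
    3!.\<close>
  define c where "c = - \<i> * deriv (deriv (deriv \<Phi>)) (of_real \<tau>) / 6"
  have cont: "(\<lambda>y. f (Complex \<tau> y)) \<in> borel_measurable borel" if "f holomorphic_on S" for f :: "complex \<Rightarrow> complex"
  proof (rule borel_measurable_continuous_onI)
    have "continuous_on S f" using that by (rule holomorphic_on_imp_continuous_on)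
    then show "continuous_on UNIV (\<lambda>y. f (Complex \<tau> y))"
      by (rule continuous_on_compose2) (use S in \<open>auto intro!: continuous_intros\<close>)
  qed
  show ?thesis
  proof (rule laplace_line[where b = b and \<delta> = "min \<delta>1 \<delta>3" and c = c and ?C1.0 = C1 and ?C3.0 = C3 and B = B
        and ?q1.0 = "\<i> * deriv g (of_real \<tau>)"])
    show "cmod (\<Phi> (Complex \<tau> y) - \<Phi> (of_real \<tau>) + of_real (V * y\<^sup>2 / 2) - c * of_real y ^ 3) \<le> C1 * y ^ 4"
      if "\<bar>y\<bar> < min \<delta>1 \<delta>3" for y
    proof -
      have eq: "\<Phi> (Complex \<tau> y) - (\<Sum>i\<le>3. (deriv ^^ i) \<Phi> (of_real \<tau>) * (\<i> * of_real y) ^ i / fact i)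
          = \<Phi> (Complex \<tau> y) - \<Phi> (of_real \<tau>) + of_real (V * y\<^sup>2 / 2) - c * of_real y ^ 3"
        using d1 d2 by (simp add: eval_nat_numeral c_def algebra_simps)
      have "cmod (\<Phi> (Complex \<tau> y) - (\<Sum>i\<le>3. (deriv ^^ i) \<Phi> (of_real \<tau>) * (\<i> * of_real y) ^ i / fact i)) \<le> C1 * y ^ 4"
        using 1(3)[of "Complex \<tau> y"] that by (simp add: line norm_mult power_abs[symmetric])
      then show ?thesis unfolding eq .
    qed
    show "cmod (g (Complex \<tau> y) - g (of_real \<tau>) - \<i> * deriv g (of_real \<tau>) * of_real y) \<le> C3 * y\<^sup>2"
      if "\<bar>y\<bar> < min \<delta>1 \<delta>3" for y
      using 3(3)[of "Complex \<tau> y"] that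
      by (simp add: line norm_mult power2_eq_square algebra_simps abs_mult_self_eq)
    show "Re (\<Phi> (Complex \<tau> y) - \<Phi> (of_real \<tau>)) \<le> - ln (1 + y\<^sup>2 / b\<^sup>2) / 2" for y
      using Re[of y] by simp
  qed (use 1 3 V b B cont[OF hol(1)] cont[OF hol(2)] in auto)
qed

section \<open>Cauchy's beta integral\<close>

lemma integral_FTC_UNIV:
  fixes F f :: "real \<Rightarrow> 'a :: euclidean_space"
  assumes "\<And>x. (F has_vector_derivative f x) (at x)" "continuous_on UNIV f" "integrable lborel f"
    and "(F \<longlongrightarrow> A) at_bot" "(F \<longlongrightarrow> B) at_top"
  shows "integral\<^sup>L lborel f = B - A"
proof -
  have "(LBINT x=-\<infinity>..\<infinity>. f x) = B - A"
    by (rule interval_integral_FTC_integrable[where F = F])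
       (use assms in \<open>auto simp: ereal_tendsto_simps set_integrable_def continuous_on_eq_continuous_at\<close>)
  then show ?thesis by (simp add: interval_integral_to_infinity_eq interval_lebesgue_integral_def set_lebesgue_integral_def)
qed

section \<open>The integrand of the beta integral on the strip\<close>

definition strip :: "complex set" where "strip = {w. 0 < Re w \<and> Re w < 1}"

definition beta_kernel :: "real \<Rightarrow> real \<Rightarrow> complex \<Rightarrow> complex" where
  "beta_kernel \<alpha> \<beta> w = w powr (- of_real \<alpha>) * (1 - w) powr (- of_real \<beta>)"

lemma open_strip: "open strip"
proof -
  have "strip = {w. 0 < Re w} \<inter> {w. Re w < 1}" by (auto simp: strip_def)
  moreover have "open ({w. 0 < Re w} \<inter> {w. Re w < 1})"
    by (intro open_Int open_halfspace_Re_gt open_halfspace_Re_lt)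
  ultimately show ?thesis by simp
qed

text \<open>Both w and 1 - w have positive real part in the strip, so the two principal powers in
  \<open>beta_kernel\<close> stay away from their branch cuts.\<close>

lemma strip_nonpos: "w \<in> strip \<Longrightarrow> w \<notin> \<real>\<^sub>\<le>\<^sub>0" "w \<in> strip \<Longrightarrow> 1 - w \<notin> \<real>\<^sub>\<le>\<^sub>0"
  by (auto simp: strip_def complex_nonpos_Reals_iff)

lemma strip_nonzero: "w \<in> strip \<Longrightarrow> w \<noteq> 0" "w \<in> strip \<Longrightarrow> 1 - w \<noteq> 0"
  by (auto simp: strip_def)

lemma Complex_in_strip: "0 < a \<Longrightarrow> a < 1 \<Longrightarrow> Complex a y \<in> strip"
  by (simp add: strip_def)

lemma beta_kernel_has_field_derivative:
  assumes "w \<in> strip"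
  shows "(beta_kernel \<alpha> \<beta> has_field_derivative
     (- of_real \<alpha> * beta_kernel (\<alpha> + 1) \<beta> w + of_real \<beta> * beta_kernel \<alpha> (\<beta> + 1) w)) (at w)"
  unfolding beta_kernel_def[abs_def]
  using strip_nonpos[OF assms] by (auto intro!: derivative_eq_intros)

lemma beta_kernel_holomorphic: "beta_kernel \<alpha> \<beta> holomorphic_on strip"
  using beta_kernel_has_field_derivative open_strip
  by (meson holomorphic_on_open)

lemma continuous_on_beta_kernel [continuous_intros]:
  assumes "continuous_on A f" "f ` A \<subseteq> strip"
  shows "continuous_on A (\<lambda>x. beta_kernel \<alpha> \<beta> (f x))"
  using continuous_on_compose2[OF holomorphic_on_imp_continuous_on[OF beta_kernel_holomorphic] assms] .

lemma beta_kernel_add_left: "w \<in> strip \<Longrightarrow> beta_kernel (\<alpha> + 1) \<beta> w * w = beta_kernel \<alpha> \<beta> w"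
  using strip_nonzero[of w] by (simp add: beta_kernel_def powr_diff)

lemma beta_kernel_add_right: "w \<in> strip \<Longrightarrow> beta_kernel \<alpha> (\<beta> + 1) w * (1 - w) = beta_kernel \<alpha> \<beta> w"
  using strip_nonzero[of w] by (simp add: beta_kernel_def powr_diff)

text \<open>Two of the \<beta> inverse powers of |1 - w| are spent on quadratic decay in y; the
  others, and those of |w|, are bounded by powers of c. The bound depends on the abscissa only
  through c, hence is uniform over a compact range of abscissas.\<close>

lemma norm_beta_kernel_le:
  assumes "0 < c" "c \<le> a" "c \<le> 1 - a" "\<alpha> \<ge> 0" "\<beta> \<ge> 2"
  shows "cmod (beta_kernel \<alpha> \<beta> (Complex a y)) \<le> c powr (- \<alpha> - \<beta>) * inverse (1 + y\<^sup>2 / c\<^sup>2)"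
proof -
  let ?w = "Complex a y"
  have 1: "c \<le> cmod ?w" using assms abs_Re_le_cmod[of ?w] by simp
  have 2: "c \<le> cmod (1 - ?w)" using assms abs_Re_le_cmod[of "1 - ?w"] by simp
  have "c\<^sup>2 \<le> (1 - a)\<^sup>2" using assms by (intro power_mono) auto
  then have 3: "c\<^sup>2 + y\<^sup>2 \<le> (cmod (1 - ?w))\<^sup>2" by (simp add: cmod_power2)
  have "cmod (beta_kernel \<alpha> \<beta> ?w) = cmod ?w powr (- \<alpha>) * cmod (1 - ?w) powr (- \<beta>)"
    by (simp add: beta_kernel_def norm_mult norm_powr_real_powr')
  also have "cmod (1 - ?w) powr (- \<beta>) = cmod (1 - ?w) powr (2 - \<beta>) * inverse ((cmod (1 - ?w))\<^sup>2)"
  proof -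
    have "cmod (1 - ?w) powr (- \<beta>) = cmod (1 - ?w) powr (2 - \<beta>) * cmod (1 - ?w) powr (- 2)"
      by (simp flip: powr_add)
    also have "cmod (1 - ?w) powr (- 2) = inverse ((cmod (1 - ?w))\<^sup>2)"
      using 2 assms by (simp add: powr_minus powr_numeral)
    finally show ?thesis .
  qed
  also have "cmod ?w powr (- \<alpha>) * (cmod (1 - ?w) powr (2 - \<beta>) * inverse ((cmod (1 - ?w))\<^sup>2))
      \<le> c powr (- \<alpha>) * (c powr (2 - \<beta>) * inverse (c\<^sup>2 + y\<^sup>2))"
    using 1 2 3 assms by (intro mult_mono powr_mono2' le_imp_inverse_le) (auto intro: add_pos_nonneg)
  also have "inverse (c\<^sup>2 + y\<^sup>2) = c powr (- 2) * inverse (1 + y\<^sup>2 / c\<^sup>2)"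
    using assms by (simp add: powr_minus powr_numeral field_simps)
  also have "c powr (- \<alpha>) * (c powr (2 - \<beta>) * (c powr (- 2) * inverse (1 + y\<^sup>2 / c\<^sup>2)))
      = c powr (- \<alpha> - \<beta>) * inverse (1 + y\<^sup>2 / c\<^sup>2)"
    by (simp add: mult.assoc[symmetric] flip: powr_add)
  finally show ?thesis .
qed

lemma integrable_beta_kernel:
  assumes "0 < a" "a < 1" "\<alpha> \<ge> 0" "\<beta> \<ge> 2"
  shows "integrable lborel (\<lambda>y. beta_kernel \<alpha> \<beta> (Complex a y))"
proof (rule Bochner_Integration.integrable_bound)
  define c where "c = min a (1 - a)"
  have c: "0 < c" "c \<le> a" "c \<le> 1 - a" using assms by (auto simp: c_def)
  show "integrable lborel (\<lambda>y. c powr (- \<alpha> - \<beta>) * inverse (1 + y\<^sup>2 / c\<^sup>2))"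
    by (intro integrable_mult_right integrable_inverse_one_plus_square_scaled c)
  have "continuous_on UNIV (\<lambda>y. beta_kernel \<alpha> \<beta> (Complex a y))"
    using Complex_in_strip[OF assms(1,2)] by (intro continuous_intros) auto
  then show "(\<lambda>y. beta_kernel \<alpha> \<beta> (Complex a y)) \<in> borel_measurable lborel"
    by (simp add: borel_measurable_continuous_onI)
  show "AE y in lborel. norm (beta_kernel \<alpha> \<beta> (Complex a y)) \<le> norm (c powr (- \<alpha> - \<beta>) * inverse (1 + y\<^sup>2 / c\<^sup>2))"
    unfolding real_norm_def
    by (intro AE_I2 order_trans[OF norm_beta_kernel_le[OF c assms(3,4)] abs_ge_self])
qed

section \<open>Recurrences for the line integral and independence of the line\<close>

definition beta_line :: "real \<Rightarrow> real \<Rightarrow> real \<Rightarrow> complex" where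
  "beta_line a \<alpha> \<beta> = (\<integral>y. beta_kernel \<alpha> \<beta> (Complex a y) \<partial>lborel)"

text \<open>The integrand is the complex derivative of \<open>beta_kernel \<alpha> \<beta>\<close>.
  Multiplied by i it is the derivative along the line, and the kernel tends to 0 at both
  ends.\<close>

lemma integral_beta_kernel_deriv:
  assumes a: "0 < a" "a < 1" and "\<alpha> \<ge> 0" "\<beta> \<ge> 2"
  shows "(\<integral>y. - of_real \<alpha> * beta_kernel (\<alpha> + 1) \<beta> (Complex a y) + of_real \<beta> * beta_kernel \<alpha> (\<beta> + 1) (Complex a y) \<partial>lborel) = 0"
    (is "integral\<^sup>L _ ?d = 0")
proof -
  define c where "c = min a (1 - a)"
  have c: "0 < c" "c \<le> a" "c \<le> 1 - a" using a by (auto simp: c_def)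
  have int: "integrable lborel ?d"
    using assms by (intro Bochner_Integration.integrable_add integrable_mult_right integrable_beta_kernel) auto
  have lim: "((\<lambda>y. beta_kernel \<alpha> \<beta> (Complex a y)) \<longlongrightarrow> 0) F" if "filterlim (\<lambda>y::real. y\<^sup>2) at_top F" for F
  proof (rule Lim_null_comparison)
    show "\<forall>\<^sub>F y in F. norm (beta_kernel \<alpha> \<beta> (Complex a y)) \<le> c powr (- \<alpha> - \<beta>) * inverse (1 + y\<^sup>2 / c\<^sup>2)"
      by (intro always_eventually allI norm_beta_kernel_le c assms)
    have top: "filterlim (\<lambda>y. 1 + inverse (c\<^sup>2) * y\<^sup>2) at_top F"
      using c by (intro filterlim_tendsto_add_at_top[OF tendsto_const]
          filterlim_tendsto_pos_mult_at_top[OF tendsto_const _ that]) auto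
    show "((\<lambda>y. c powr (- \<alpha> - \<beta>) * inverse (1 + y\<^sup>2 / c\<^sup>2)) \<longlongrightarrow> 0) F"
      using tendsto_mult_right_zero[OF tendsto_inverse_0_at_top[OF top]]
      by (simp add: divide_inverse mult.commute)
  qed
  have "(\<integral>y. \<i> * ?d y \<partial>lborel) = 0 - 0"
  proof (rule integral_FTC_UNIV)
    show "((\<lambda>y. beta_kernel \<alpha> \<beta> (Complex a y)) has_vector_derivative \<i> * ?d y) (at y)" for y
    proof -
      have "((\<lambda>y. Complex a y) has_vector_derivative \<i>) (at y)"
        unfolding complex_of_real_def[symmetric] has_vector_derivative_complex_iff by (auto intro!: derivative_eq_intros)
      from field_vector_diff_chain_at[OF this beta_kernel_has_field_derivative]
      show ?thesis using Complex_in_strip[OF a] by (simp add: o_def)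
    qed
    show "continuous_on UNIV (\<lambda>y. \<i> * ?d y)"
      using Complex_in_strip[OF a] by (intro continuous_intros) auto
    show "((\<lambda>y. beta_kernel \<alpha> \<beta> (Complex a y)) \<longlongrightarrow> 0) at_bot"
      by (rule lim) real_asymp
    show "((\<lambda>y. beta_kernel \<alpha> \<beta> (Complex a y)) \<longlongrightarrow> 0) at_top"
      by (rule lim) real_asymp
    show "integrable lborel (\<lambda>y. \<i> * ?d y)"
      using int by (rule integrable_mult_right)
  qed
  then show ?thesis by simp
qed

lemma beta_line_shift_exponent:
  assumes "0 < a" "a < 1" "\<alpha> \<ge> 0" "\<beta> \<ge> 2"
  shows "of_real \<alpha> * beta_line a (\<alpha> + 1) \<beta> = of_real \<beta> * beta_line a \<alpha> (\<beta> + 1)"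
  using integral_beta_kernel_deriv[OF assms] assms
  by (simp add: beta_line_def integrable_beta_kernel del: minus_mult_left)

text \<open>Inserting 1 = (1 - w) + w into the integrand lowers one exponent in each
  summand.\<close>

lemma beta_line_split:
  assumes "0 < a" "a < 1" "\<alpha> \<ge> 0" "\<beta> \<ge> 2"
  shows "beta_line a (\<alpha> + 1) (\<beta> + 1) = beta_line a \<alpha> (\<beta> + 1) + beta_line a (\<alpha> + 1) \<beta>"
proof -
  have "beta_kernel (\<alpha> + 1) (\<beta> + 1) w = beta_kernel \<alpha> (\<beta> + 1) w + beta_kernel (\<alpha> + 1) \<beta> w" if "w \<in> strip" for w
    using beta_kernel_add_left[OF that, of \<alpha> "\<beta> + 1"] beta_kernel_add_right[OF that, of "\<alpha> + 1" \<beta>]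
    by (simp add: algebra_simps)
  then show ?thesis
    using assms by (simp add: beta_line_def integrable_beta_kernel Complex_in_strip)
qed

text \<open>The integration-by-parts relation and the splitting, each used at \<beta> and at \<beta>
  - 1, express all neighbouring values through the one at (\<alpha>, \<beta>). The use at \<beta> -
  1 >= 2 accounts for the hypothesis on \<beta>. The factor is the one by which Gamma (\<alpha> +
  \<beta> - 1) / (Gamma \<alpha> * Gamma \<beta>) changes.\<close>

lemma beta_line_Suc:
  assumes "0 < a" "a < 1" "\<alpha> > 0" "\<beta> \<ge> 3"
  shows "beta_line a (\<alpha> + 1) (\<beta> + 1) = of_real ((\<alpha> + \<beta>) * (\<alpha> + \<beta> - 1) / (\<alpha> * \<beta>)) * beta_line a \<alpha> \<beta>"
proof -
  have 1: "of_real \<alpha> * beta_line a (\<alpha> + 1) \<beta> = of_real \<beta> * beta_line a \<alpha> (\<beta> + 1)"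
    "beta_line a (\<alpha> + 1) (\<beta> + 1) = beta_line a \<alpha> (\<beta> + 1) + beta_line a (\<alpha> + 1) \<beta>"
    using assms by (intro beta_line_shift_exponent beta_line_split; simp)+
  have 2: "of_real \<alpha> * beta_line a (\<alpha> + 1) (\<beta> - 1) = of_real (\<beta> - 1) * beta_line a \<alpha> \<beta>"
    "beta_line a (\<alpha> + 1) \<beta> = beta_line a \<alpha> \<beta> + beta_line a (\<alpha> + 1) (\<beta> - 1)"
    using beta_line_shift_exponent[of a \<alpha> "\<beta> - 1"] beta_line_split[of a \<alpha> "\<beta> - 1"] assms by simp_all
  define x y z :: complex where "x = of_real \<alpha>" "y = of_real \<beta>" "z = beta_line a \<alpha> \<beta>"
  have nz: "x \<noteq> 0" "y \<noteq> 0" using assms by (auto simp: x_y_z_def)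
  have "beta_line a (\<alpha> + 1) (\<beta> - 1) = (y - 1) * z / x"
    using 2(1) nz by (simp add: x_y_z_def field_simps)
  then have 3: "beta_line a (\<alpha> + 1) \<beta> = z + (y - 1) * z / x" using 2(2) by (simp add: x_y_z_def)
  have "beta_line a \<alpha> (\<beta> + 1) = x * (z + (y - 1) * z / x) / y"
    using 1(1) 3 nz by (simp add: x_y_z_def field_simps)
  then have "beta_line a (\<alpha> + 1) (\<beta> + 1) = x * (z + (y - 1) * z / x) / y + (z + (y - 1) * z / x)"
    using 1(2) 3 by simp
  also have "\<dots> = (x + y) * (x + y - 1) / (x * y) * z" using nz by (simp add: divide_simps) (simp add: algebra_simps)
  finally show ?thesis by (simp add: x_y_z_def)
qed

text \<open>The complex derivative of the kernel is integrated over the strip between the two lines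
  in both orders. Integrating vertically first gives 0 for every abscissa; integrating horizontally
  first gives the difference of the two line integrals.\<close>

lemma beta_line_shift_abscissa:
  assumes ab: "0 < a" "a \<le> b" "b < 1" and "\<alpha> \<ge> 0" "\<beta> \<ge> 2"
  shows "beta_line a \<alpha> \<beta> = beta_line b \<alpha> \<beta>"
proof -
  define d where "d = (\<lambda>w. - of_real \<alpha> * beta_kernel (\<alpha> + 1) \<beta> w + of_real \<beta> * beta_kernel \<alpha> (\<beta> + 1) w)"
  define f where "f = (\<lambda>x y. indicator {a..b} x *\<^sub>R d (Complex x y))"
  \<comment> \<open>The smallest distance of any abscissa in [a, b] from 0 and 1, so that the
    majorant \<open>h\<close> does not depend on x and Fubini's theorem applies.\<close>
  define c where "c = min a (1 - b)"
  have c: "0 < c" "c \<le> x" "c \<le> 1 - x" if "x \<in> {a..b}" for x using ab that by (auto simp: c_def)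
  define K where "K = \<alpha> * c powr (- (\<alpha> + 1) - \<beta>) + \<beta> * c powr (- \<alpha> - (\<beta> + 1))"
  define h where "h = (\<lambda>y::real. K * inverse (1 + y\<^sup>2 / c\<^sup>2))"
  have c0: "c > 0" using c[of a] ab by auto
  have h: "integrable lborel h" unfolding h_def
    by (intro integrable_mult_right integrable_inverse_one_plus_square_scaled c0)
  have d: "cmod (d (Complex x y)) \<le> h y" if x: "x \<in> {a..b}" for x y
  proof -
    have "cmod (d (Complex x y)) \<le> \<alpha> * cmod (beta_kernel (\<alpha> + 1) \<beta> (Complex x y)) + \<beta> * cmod (beta_kernel \<alpha> (\<beta> + 1) (Complex x y))"
      unfolding d_def using assms by (intro order_trans[OF norm_triangle_ineq] add_mono) (auto simp: norm_mult)
    also have "\<dots> \<le> \<alpha> * (c powr (- (\<alpha> + 1) - \<beta>) * inverse (1 + y\<^sup>2 / c\<^sup>2)) + \<beta> * (c powr (- \<alpha> - (\<beta> + 1)) * inverse (1 + y\<^sup>2 / c\<^sup>2))"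
      using assms c[OF x] by (intro add_mono mult_left_mono norm_beta_kernel_le) auto
    finally show ?thesis by (simp add: h_def K_def algebra_simps)
  qed
  have "integrable (lborel \<Otimes>\<^sub>M lborel) (case_prod f)"
  proof (rule Bochner_Integration.integrable_bound)
    show "integrable (lborel \<Otimes>\<^sub>M lborel) (\<lambda>(x, y). indicator {a..b} x * h y)"
    proof (rule lborel_pair.Fubini_integrable)
      have [measurable]: "h \<in> borel_measurable borel" using borel_measurable_integrable[OF h] by simp
      show "(\<lambda>(x, y). indicator {a..b} x * h y) \<in> borel_measurable (lborel \<Otimes>\<^sub>M lborel)" by measurable
      have "integrable lborel (\<lambda>x. indicator {a..b} x *\<^sub>R (\<integral>y. norm (h y) \<partial>lborel))"
        by (intro integrable_scaleR_left integrable_real_indicator) (auto simp: emeasure_lborel_Icc_eq)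
      then show "integrable lborel (\<lambda>x. \<integral>y. norm (case (x, y) of (x, y) \<Rightarrow> indicator {a..b} x * h y) \<partial>lborel)"
        by (simp add: abs_mult)
      show "AE x in lborel. integrable lborel (\<lambda>y. case (x, y) of (x, y) \<Rightarrow> indicator {a..b} x * h y)"
        using h by auto
    qed
    have "continuous_on ({a..b} \<times> UNIV) (\<lambda>p. d (Complex (fst p) (snd p)))"
      unfolding d_def using ab by (intro continuous_intros) (auto intro!: Complex_in_strip)
    then have "(\<lambda>p. indicator ({a..b} \<times> UNIV) p *\<^sub>R d (Complex (fst p) (snd p))) \<in> borel_measurable borel"
      by (intro borel_measurable_continuous_on_indicator) (auto intro!: borel_closed closed_Times)
    also have "(\<lambda>p. indicator ({a..b} \<times> UNIV) p *\<^sub>R d (Complex (fst p) (snd p))) = case_prod f"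
      by (auto simp: f_def fun_eq_iff indicator_def)
    finally show "case_prod f \<in> borel_measurable (lborel \<Otimes>\<^sub>M lborel)" by (simp add: lborel_prod)
    have "norm (case_prod f p) \<le> norm (case p of (x, y) \<Rightarrow> indicator {a..b} x * h y)" for p
      using d order_trans[OF d abs_ge_self] by (auto simp: f_def indicator_def split: prod.splits)
    then show "AE p in lborel \<Otimes>\<^sub>M lborel. norm (case_prod f p) \<le> norm (case p of (x, y) \<Rightarrow> indicator {a..b} x * h y)"
      by simp
  qed
  then have "(\<integral>y. (\<integral>x. f x y \<partial>lborel) \<partial>lborel) = (\<integral>x. (\<integral>y. f x y \<partial>lborel) \<partial>lborel)"
    by (rule lborel_pair.Fubini_integral)
  also have "(\<lambda>x. \<integral>y. f x y \<partial>lborel) = (\<lambda>x. 0)"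
    using integral_beta_kernel_deriv[of _ \<alpha> \<beta>] assms by (auto simp: f_def d_def indicator_def fun_eq_iff)
  also have "(\<lambda>y. \<integral>x. f x y \<partial>lborel) = (\<lambda>y. beta_kernel \<alpha> \<beta> (Complex b y) - beta_kernel \<alpha> \<beta> (Complex a y))"
  proof
    fix y
    show "(\<integral>x. f x y \<partial>lborel) = beta_kernel \<alpha> \<beta> (Complex b y) - beta_kernel \<alpha> \<beta> (Complex a y)"
      unfolding f_def
    proof (rule integral_FTC_atLeastAtMost)
      fix x assume x: "a \<le> x" "x \<le> b"
      have "((\<lambda>x. Complex x y) has_vector_derivative 1) (at x)"
        unfolding has_vector_derivative_complex_iff by (auto intro!: derivative_eq_intros)
      from field_vector_diff_chain_at[OF this beta_kernel_has_field_derivative]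
      have "((\<lambda>x. beta_kernel \<alpha> \<beta> (Complex x y)) has_vector_derivative d (Complex x y)) (at x)"
        using Complex_in_strip[of x y] x ab by (simp add: o_def d_def)
      then show "((\<lambda>x. beta_kernel \<alpha> \<beta> (Complex x y)) has_vector_derivative d (Complex x y)) (at x within {a..b})"
        by (rule has_vector_derivative_at_within)
    next
      show "continuous_on {a..b} (\<lambda>x. d (Complex x y))"
        unfolding d_def using ab by (intro continuous_intros) (auto intro!: Complex_in_strip)
    qed (use ab in auto)
  qed
  finally show ?thesis
    using integrable_beta_kernel[of _ \<alpha> \<beta>] assms by (simp add: beta_line_def)
qed

section \<open>The explicit value at \<alpha> = \<beta> = 3\<close>

lemma beta_kernel_3_3_half: "beta_kernel 3 3 (Complex (1 / 2) y) = of_real (64 / (1 + (2 * y)\<^sup>2) ^ 3)"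
proof -
  let ?w = "Complex (1 / 2) y"
  have nz: "?w \<noteq> 0" "1 - ?w \<noteq> 0" by (auto simp: complex_eq_iff)
  \<comment> \<open>On the line Re w = 1/2 the number 1 - w is the conjugate of w, so the product is
    |w|^2 and the kernel with equal exponents is real and rational in y.\<close>
  have eq: "?w * (1 - ?w) = of_real ((1 + (2 * y)\<^sup>2) / 4)"
    by (simp add: complex_eq_iff power2_eq_square)
  have "inverse ((?w * (1 - ?w)) ^ 3) = of_real (inverse (((1 + (2 * y)\<^sup>2) / 4) ^ 3))"
    by (simp only: eq of_real_inverse of_real_power)
  also have "inverse (((1 + (2 * y)\<^sup>2) / 4) ^ 3) = 64 / (1 + (2 * y)\<^sup>2) ^ 3" by (simp add: power_divide)
  finally show ?thesis
    using nz powr_complexpow[of ?w 3] powr_complexpow[of "1 - ?w" 3]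
    by (simp add: beta_kernel_def powr_minus power_mult_distrib)
qed

text \<open>This is the classical reduction formula for the integral of 1 / (1 + s^2)^3, multiplied
  by 32 to clear denominators; s = 2 y supplies the missing factor 2.\<close>

lemma inverse_cube_antideriv:
  fixes s :: real
  shows "((\<lambda>s. 8 * s / (1 + s\<^sup>2)\<^sup>2 + 12 * s / (1 + s\<^sup>2) + 12 * arctan s) has_real_derivative 32 / (1 + s\<^sup>2) ^ 3) (at s)"
proof -
  define r where "r = 1 + s\<^sup>2"
  have r: "r > 0" "s\<^sup>2 = r - 1" "1 + s\<^sup>2 = r" by (auto simp: r_def add_pos_nonneg)
  have R: "((\<lambda>s. 1 + s\<^sup>2) has_real_derivative 2 * s) (at s)" by (auto intro!: derivative_eq_intros)
  have R2: "((\<lambda>s. (1 + s\<^sup>2)\<^sup>2) has_real_derivative 2 * r * (2 * s)) (at s)"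
    using DERIV_power[OF R, of 2] by (simp add: r_def mult_ac)
  have I: "((\<lambda>s. c * s) has_real_derivative c) (at s)" for c :: real by (auto intro!: derivative_eq_intros)
  have D: "((\<lambda>s. 8 * s / (1 + s\<^sup>2)\<^sup>2 + 12 * s / (1 + s\<^sup>2) + 12 * arctan s) has_real_derivative
     (8 * r\<^sup>2 - 8 * s * (2 * r * (2 * s))) / (r\<^sup>2 * r\<^sup>2) + (12 * r - 12 * s * (2 * s)) / (r * r) + 12 * inverse r) (at s)"
    using DERIV_add[OF DERIV_add[OF DERIV_divide[OF I R2] DERIV_divide[OF I R]] DERIV_cmult[OF DERIV_arctan], of 8 12 12] r
    by simp
  have e: "8 * s * (2 * r * (2 * s)) = 32 * r * (r - 1)" "12 * s * (2 * s) = 24 * (r - 1)"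
    unfolding r(2)[symmetric] by (simp_all add: power2_eq_square)
  have "(8 * r\<^sup>2 - 8 * s * (2 * r * (2 * s))) / (r\<^sup>2 * r\<^sup>2) + (12 * r - 12 * s * (2 * s)) / (r * r) + 12 * inverse r = 32 / r ^ 3"
    unfolding e using r(1) by (simp add: field_simps eval_nat_numeral)
  with D show ?thesis by (simp add: r)
qed
text \<open>The anchor for the recurrence: \<beta> = 3 is the least exponent it admits, and \<alpha>
  = \<beta> makes the integrand elementary. The value agrees with 2 pi Gamma 5 / (Gamma 3)^2 = 2 pi
  * 24 / 4.\<close>

lemma beta_line_3_3: "beta_line (1 / 2) 3 3 = of_real (12 * pi)"
proof -
  define G where "G = (\<lambda>s::real. 8 * s / (1 + s\<^sup>2)\<^sup>2 + 12 * s / (1 + s\<^sup>2) + 12 * arctan s)"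
  define F where "F = (\<lambda>y. G (2 * y))"
  have int: "integrable lborel (\<lambda>y::real. 64 / (1 + (2 * y)\<^sup>2) ^ 3)"
    using integrable_beta_kernel[of "1 / 2" 3 3, unfolded beta_kernel_3_3_half complex_of_real_integrable_eq]
    by simp
  have "(\<integral>y. 64 / (1 + (2 * y)\<^sup>2) ^ 3 \<partial>lborel) = 12 * (pi / 2) - 12 * (- (pi / 2))"
  proof (rule integral_FTC_UNIV[where F = F])
    fix y :: real
    have "(F has_real_derivative 32 / (1 + (2 * y)\<^sup>2) ^ 3 * 2) (at y)"
      unfolding F_def G_def
      by (rule DERIV_chain2[OF inverse_cube_antideriv]) (auto intro!: derivative_eq_intros)
    then show "(F has_vector_derivative 64 / (1 + (2 * y)\<^sup>2) ^ 3) (at y)"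
      by (simp add: has_real_derivative_iff_has_vector_derivative)
  next
    have "(1::real) + (2 * y)\<^sup>2 \<noteq> 0" for y :: real by (metis add_pos_nonneg less_irrefl zero_le_power2 zero_less_one)
    then show "continuous_on UNIV (\<lambda>y::real. 64 / (1 + (2 * y)\<^sup>2) ^ 3)"
      by (intro continuous_intros) auto
    show "(F \<longlongrightarrow> 12 * (- (pi / 2))) at_bot" unfolding F_def G_def by real_asymp
    show "(F \<longlongrightarrow> 12 * (pi / 2)) at_top" unfolding F_def G_def by real_asymp
  qed (fact int)
  then show ?thesis
    unfolding beta_line_def beta_kernel_3_3_half integral_complex_of_real by simp
qed

section \<open>Growth of both sides when the two exponents are raised together\<close>

lemma Gamma_asymp_ratio:
  fixes z :: real
  assumes "z > 0"
  shows "(\<lambda>n. fact (n - 1) * real n powr z / Gamma (z + real n)) \<longlonglongrightarrow> 1"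
proof -
  have z: "z \<notin> \<int>\<^sub>\<le>\<^sub>0" "Gamma z > 0" using assms by (auto simp: nonpos_Ints_def)
  have "(\<lambda>n. Gamma_series' z n / Gamma z) \<longlonglongrightarrow> Gamma z / Gamma z"
    using z by (intro tendsto_intros Gamma_series'_LIMSEQ) auto
  moreover have "\<forall>\<^sub>F n in sequentially. Gamma_series' z n / Gamma z = fact (n - 1) * real n powr z / Gamma (z + real n)"
    using eventually_gt_at_top[of 0]
  proof eventually_elim
    case (elim n)
    \<comment> \<open>This identity turns the limit formula for Gamma z into Gamma (z + n) ~ (n -
      1)! n^z.\<close>
    have "Gamma (z + real n) = pochhammer z n * Gamma z"
      using z by (simp add: pochhammer_Gamma)
    then show ?case using elim by (simp add: Gamma_series'_def powr_def mult.commute)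
  qed
  ultimately show ?thesis using z by (simp add: tendsto_cong)
qed

lemma deriv_deriv_eq:
  assumes "open S" "z \<in> S" "\<And>w. w \<in> S \<Longrightarrow> (f has_field_derivative f' w) (at w)"
    and "(f' has_field_derivative d) (at z)"
  shows "deriv f z = f' z" "deriv (deriv f) z = d"
proof -
  have *: "deriv f w = f' w" if "w \<in> S" for w using assms(3)[OF that] by (rule DERIV_imp_deriv)
  then show "deriv f z = f' z" using assms by blast
  have "deriv (deriv f) z = deriv f' z"
    using eventually_nhds_in_open[OF assms(1,2)] * by (intro deriv_cong_ev) (auto elim!: eventually_mono)
  then show "deriv (deriv f) z = d" using DERIV_imp_deriv[OF assms(4)] by simp
qed

lemma Ln_half: "Ln (1 / 2) = - of_real (ln 2)"
  using Ln_of_real[of "1 / 2"] by (simp add: ln_div)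

text \<open>Raising both exponents by n multiplies the kernel by exp (n \<Phi>) with \<Phi> = -log w
  - log (1 - w), whose saddle point is 1/2. There exp \<Phi> = 4 and the second derivative is 4 + 4
  = 8, so the Gaussian factor is sqrt (2 pi / 8) and the amplitude is 2 powr (\<alpha> +
  \<beta>).\<close>

lemma beta_line_half_tendsto:
  assumes "\<alpha> \<ge> 0" "\<beta> \<ge> 2"
  shows "(\<lambda>n. of_real (sqrt (real n) / 4 ^ n) * beta_line (1 / 2) (\<alpha> + real n) (\<beta> + real n))
           \<longlonglongrightarrow> of_real (2 powr (\<alpha> + \<beta>) * sqrt (pi / 4))"
proof -
  define \<Phi> where "\<Phi> = (\<lambda>w. - Ln w - Ln (1 - w))"
  define \<Phi>' :: "complex \<Rightarrow> complex" where "\<Phi>' = (\<lambda>w. - inverse w + inverse (1 - w))"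
  have half: "complex_of_real (1 / 2) \<in> strip" by (simp add: strip_def)
  have line: "Complex (1 / 2) y \<in> strip" for y by (rule Complex_in_strip) auto
  have \<Phi>_deriv: "(\<Phi> has_field_derivative \<Phi>' w) (at w)" if "w \<in> strip" for w
    unfolding \<Phi>_def \<Phi>'_def using strip_nonpos[OF that] strip_nonzero[OF that]
    by (auto intro!: derivative_eq_intros simp: field_simps)
  have \<Phi>'_deriv: "(\<Phi>' has_field_derivative of_real 8) (at (of_real (1 / 2)))"
    unfolding \<Phi>'_def by (auto intro!: derivative_eq_intros simp: power2_eq_square)
  note d = deriv_deriv_eq[OF open_strip half \<Phi>_deriv \<Phi>'_deriv]
  have \<Phi>_half: "\<Phi> (of_real (1 / 2)) = of_real (2 * ln 2)" by (simp add: \<Phi>_def Ln_half)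
  have "\<exists>C. \<forall>k\<ge>8. cmod (of_real (sqrt k) *
           (\<integral>y. exp (of_real k * (\<Phi> (Complex (1 / 2) y) - \<Phi> (of_real (1 / 2)))) * beta_kernel \<alpha> \<beta> (Complex (1 / 2) y) \<partial>lborel)
           - beta_kernel \<alpha> \<beta> (of_real (1 / 2)) * of_real (sqrt (2 * pi / 8))) \<le> C / k"
  proof (rule laplace_vertical[OF open_strip line _ beta_kernel_holomorphic, where b = "1 / 2"
        and B = "(1 / 2) powr (- \<alpha> - \<beta>)"])
    show "\<Phi> holomorphic_on strip" using \<Phi>_deriv open_strip by (meson holomorphic_on_open)
    show "deriv \<Phi> (of_real (1 / 2)) = 0" using d(1) by (simp add: \<Phi>'_def)
    show "deriv (deriv \<Phi>) (of_real (1 / 2)) = of_real 8" using d(2) by simp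
    show "Re (\<Phi> (Complex (1 / 2) y)) \<le> Re (\<Phi> (of_real (1 / 2))) - ln (1 + y\<^sup>2 / (1 / 2)\<^sup>2) / 2" for y
    proof -
      have pos: "1 + 4 * y\<^sup>2 > 0" by (simp add: add_pos_nonneg)
      have "cmod (Complex (1 / 2) y) = sqrt ((1 + 4 * y\<^sup>2) / 4)" "cmod (1 - Complex (1 / 2) y) = sqrt ((1 + 4 * y\<^sup>2) / 4)"
        by (simp_all add: cmod_def power2_eq_square add_divide_distrib)
      then have "Re (\<Phi> (Complex (1 / 2) y)) = - ln ((1 + 4 * y\<^sup>2) / 4)"
        using strip_nonzero[OF line[of y]] by (simp add: \<Phi>_def ln_sqrt add_pos_nonneg)
      also have "\<dots> = 2 * ln 2 - ln (1 + 4 * y\<^sup>2)"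
        using ln_realpow[of 2 2] pos by (subst ln_div) auto
      \<comment> \<open>Both |w| and |1 - w| grow along this line, so the actual drop is twice what
        \<open>laplace_vertical\<close> asks for.\<close>
      also have "\<dots> \<le> 2 * ln 2 - ln (1 + 4 * y\<^sup>2) / 2" by simp
      finally show ?thesis by (simp add: \<Phi>_half power_divide mult.commute del: of_real_divide)
    qed
    show "cmod (beta_kernel \<alpha> \<beta> (Complex (1 / 2) y)) \<le> (1 / 2) powr (- \<alpha> - \<beta>)" for y
    proof -
      have "cmod (beta_kernel \<alpha> \<beta> (Complex (1 / 2) y)) \<le> (1 / 2) powr (- \<alpha> - \<beta>) * inverse (1 + y\<^sup>2 / (1 / 2)\<^sup>2)"
        by (rule norm_beta_kernel_le) (use assms in auto)
      also have "\<dots> \<le> (1 / 2) powr (- \<alpha> - \<beta>) * 1"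
        by (intro mult_left_mono) (auto simp: inverse_le_1_iff)
      finally show ?thesis by simp
    qed
  qed (auto simp: power2_eq_square)
  then obtain C where C: "\<And>k. k \<ge> 8 \<Longrightarrow> cmod (of_real (sqrt k) *
           (\<integral>y. exp (of_real k * (\<Phi> (Complex (1 / 2) y) - \<Phi> (of_real (1 / 2)))) * beta_kernel \<alpha> \<beta> (Complex (1 / 2) y) \<partial>lborel)
           - beta_kernel \<alpha> \<beta> (of_real (1 / 2)) * of_real (sqrt (2 * pi / 8))) \<le> C / k"
    by blast
  have integrand: "exp (of_real (real n) * (\<Phi> w - \<Phi> (of_real (1 / 2)))) * beta_kernel \<alpha> \<beta> w
      = of_real (1 / 4 ^ n) * beta_kernel (\<alpha> + real n) (\<beta> + real n) w" if "w \<in> strip" for w n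
  proof -
    have "exp (of_real (real n) * \<Phi> (of_real (1 / 2))) = of_real (exp (real n * (2 * ln 2)))"
      by (simp only: \<Phi>_half exp_of_real of_real_mult[symmetric])
    also have "exp (real n * (2 * ln 2)) = 4 ^ n"
      using exp_of_nat_mult[of n "2 * ln 2 :: real"] exp_of_nat_mult[of 2 "ln 2 :: real"] by simp
    finally have 4: "exp (of_real (real n) * \<Phi> (of_real (1 / 2))) = 4 ^ n" by simp
    have "exp (of_real (real n) * \<Phi> w) * beta_kernel \<alpha> \<beta> w = beta_kernel (\<alpha> + real n) (\<beta> + real n) w"
      using strip_nonzero[OF that]
      by (simp add: beta_kernel_def powr_def \<Phi>_def algebra_simps flip: exp_add)
    then show ?thesis unfolding right_diff_distrib exp_diff 4 by (simp add: field_simps)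
  qed
  have beta_half: "beta_kernel \<alpha> \<beta> (of_real (1 / 2)) = of_real (2 powr (\<alpha> + \<beta>))"
    by (simp add: beta_kernel_def powr_def Ln_half exp_of_real[symmetric] algebra_simps flip: exp_add)
  have "(\<lambda>n. of_real (sqrt (real n)) * (of_real (1 / 4 ^ n) * beta_line (1 / 2) (\<alpha> + real n) (\<beta> + real n))
      - of_real (2 powr (\<alpha> + \<beta>)) * of_real (sqrt (2 * pi / 8))) \<longlonglongrightarrow> 0"
  proof (rule Lim_null_comparison)
    show "\<forall>\<^sub>F n in sequentially. norm (of_real (sqrt (real n)) * (of_real (1 / 4 ^ n) * beta_line (1 / 2) (\<alpha> + real n) (\<beta> + real n))
      - of_real (2 powr (\<alpha> + \<beta>)) * of_real (sqrt (2 * pi / 8))) \<le> C / real n"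
      using eventually_ge_at_top[of 8]
    proof eventually_elim
      case (elim n)
      have "(\<integral>y. exp (of_real (real n) * (\<Phi> (Complex (1 / 2) y) - \<Phi> (of_real (1 / 2)))) * beta_kernel \<alpha> \<beta> (Complex (1 / 2) y) \<partial>lborel)
          = of_real (1 / 4 ^ n) * beta_line (1 / 2) (\<alpha> + real n) (\<beta> + real n)"
        unfolding integrand[OF line] beta_line_def by simp
      then show ?case using C[of "real n"] elim unfolding beta_half by simp
    qed
    show "(\<lambda>n. C / real n) \<longlonglongrightarrow> 0" by (rule lim_const_over_n)
  qed
  then show ?thesis by (simp add: LIM_zero_iff mult.assoc)
qed

text \<open>
  The quotient of the two sides is invariant under \<open>(\<alpha>, \<beta>) \<mapsto> (\<alpha> + 1, \<beta> + 1)\<close>. Along this shift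
  both sides grow, relative to the case \<open>\<alpha> = \<beta> = 3\<close>, by the same factor \<open>2 powr (\<alpha> + \<beta> - 6)\<close> in
  the limit, so the quotient is the one at \<open>\<alpha> = \<beta> = 3\<close>, where the integral is elementary.
\<close>
lemma beta_line_half:
  assumes "\<alpha> > 0" "\<beta> \<ge> 3"
  shows "beta_line (1 / 2) \<alpha> \<beta> = of_real (2 * pi * Gamma (\<alpha> + \<beta> - 1) / (Gamma \<alpha> * Gamma \<beta>))"
proof -
  define Q where "Q = (\<lambda>\<alpha> \<beta>::real. Gamma (\<alpha> + \<beta> - 1) / (Gamma \<alpha> * Gamma \<beta>))"
  define I where "I = beta_line (1 / 2)"
  have Q_pos: "Q \<alpha> \<beta> > 0" if "\<alpha> > 0" "\<beta> \<ge> 3" for \<alpha> \<beta>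
    using that by (auto simp: Q_def)
  have inv: "I (\<alpha> + real n) (\<beta> + real n) / of_real (Q (\<alpha> + real n) (\<beta> + real n)) = I \<alpha> \<beta> / of_real (Q \<alpha> \<beta>)"
    if "\<alpha> > 0" "\<beta> \<ge> 3" for \<alpha> \<beta> n
  proof (induction n)
    case (Suc n)
    define x y where "x = \<alpha> + real n" and "y = \<beta> + real n"
    have xy: "x > 0" "y \<ge> 3" using that by (auto simp: x_def y_def)
    have G: "Gamma (x + 1) = x * Gamma x" "Gamma (y + 1) = y * Gamma y"
      "Gamma (x + y - 1 + 1 + 1) = (x + y) * ((x + y - 1) * Gamma (x + y - 1))"
      using xy Gamma_plus1[of x] Gamma_plus1[of y] Gamma_plus1[of "x + y - 1"] Gamma_plus1[of "x + y"]
      by (auto simp: nonpos_Ints_def)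
    define r where "r = (x + y) * (x + y - 1) / (x * y)"
    have r: "r > 0" using xy by (simp add: r_def)
    have "Q (x + 1) (y + 1) = r * Q x y"
    proof -
      have "x + 1 + (y + 1) - 1 = x + y - 1 + 1 + 1" by simp
      then show ?thesis unfolding Q_def r_def by (simp only: G) (simp add: mult_ac)
    qed
    moreover have "I (x + 1) (y + 1) = of_real r * I x y"
      unfolding I_def r_def using xy by (intro beta_line_Suc) auto
    ultimately have "I (x + 1) (y + 1) / of_real (Q (x + 1) (y + 1)) = I x y / of_real (Q x y)"
      using r by simp
    then show ?case using Suc by (simp add: x_def y_def add_ac)
  qed simp
  define X where "X = (\<lambda>\<alpha> \<beta> n. of_real (sqrt (real n) / 4 ^ n) * I (\<alpha> + real n) (\<beta> + real n))"
  have X: "X \<alpha> \<beta> \<longlonglongrightarrow> of_real (2 powr (\<alpha> + \<beta>) * sqrt (pi / 4))" if "\<alpha> > 0" "\<beta> \<ge> 3" for \<alpha> \<beta>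
    unfolding X_def I_def using that by (intro beta_line_half_tendsto) auto
  have X_ratio: "(\<lambda>n. X \<alpha> \<beta> n / X 3 3 n) \<longlonglongrightarrow> of_real (2 powr (\<alpha> + \<beta> - 6))"
  proof -
    have "(\<lambda>n. X \<alpha> \<beta> n / X 3 3 n) \<longlonglongrightarrow>
        of_real (2 powr (\<alpha> + \<beta>) * sqrt (pi / 4)) / of_real (2 powr (3 + 3) * sqrt (pi / 4))"
      using assms by (intro tendsto_divide X) auto
    also have "of_real (2 powr (\<alpha> + \<beta>) * sqrt (pi / 4)) / of_real (2 powr (3 + 3) * sqrt (pi / 4))
        = complex_of_real (2 powr (\<alpha> + \<beta> - 6))"
      by (simp only: of_real_divide[symmetric]) (simp add: powr_diff)
    finally show ?thesis .
  qed
  define v :: "real \<Rightarrow> nat \<Rightarrow> real" where "v = (\<lambda>z n. fact (n - 1) * real n powr z / Gamma (z + real n))"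
  have v: "v z \<longlonglongrightarrow> 1" if "z > 0" for z unfolding v_def by (rule Gamma_asymp_ratio) (fact that)
  \<comment> \<open>The numerator of \<open>Q\<close> is evaluated at \<alpha> + \<beta> - 1 + 2 n,
    which calls for the even subsequence.\<close>
  have v2: "(\<lambda>n. v z (2 * n)) \<longlonglongrightarrow> 1" if "z > 0" for z
    using v[OF that] by (rule filterlim_compose) (auto intro: mult_nat_left_at_top)
  have Q_ratio: "(\<lambda>n. Q (\<alpha> + real n) (\<beta> + real n) / Q (3 + real n) (3 + real n)) \<longlonglongrightarrow> 2 powr (\<alpha> + \<beta> - 6)"
  proof -
    \<comment> \<open>The factorials and the powers of n cancel between the two quotients. The
      doubled index contributes (2 n) powr (\<alpha> + \<beta> - 1) against (2 n) powr 5, and this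
      is the origin of 2 powr (\<alpha> + \<beta> - 6).\<close>
    have "(\<lambda>n. v \<alpha> n * v \<beta> n * v 5 (2 * n) / (v (\<alpha> + \<beta> - 1) (2 * n) * v 3 n * v 3 n) * 2 powr (\<alpha> + \<beta> - 6))
        \<longlonglongrightarrow> 1 * 1 * 1 / (1 * 1 * 1) * 2 powr (\<alpha> + \<beta> - 6)"
      using assms by (intro tendsto_intros v v2) auto
    moreover have "\<forall>\<^sub>F n in sequentially. v \<alpha> n * v \<beta> n * v 5 (2 * n) / (v (\<alpha> + \<beta> - 1) (2 * n) * v 3 n * v 3 n) * 2 powr (\<alpha> + \<beta> - 6)
        = Q (\<alpha> + real n) (\<beta> + real n) / Q (3 + real n) (3 + real n)"
      using eventually_gt_at_top[of 0]
    proof eventually_elim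
      case (elim n)
      define f :: real where "f = fact (n - 1)"
      define f2 :: real where "f2 = fact (2 * n - 1)"
      define N where "N = real n"
      have f: "f > 0" "f2 > 0" "N > 0" using elim by (auto simp: f_def f2_def N_def)
      define G where "G = (\<lambda>z. Gamma (z + N))"
      define G2 where "G2 = (\<lambda>z. Gamma (z + 2 * N))"
      have G: "G z > 0" "G2 z > 0" if "z > 0" for z using that f by (auto simp: G_def G2_def)
      have vn: "v z n = f * N powr z / G z" "v z (2 * n) = f2 * (2 * N) powr z / G2 z" for z
        by (simp_all add: v_def f_def f2_def N_def G_def G2_def)
      have Qn: "Q (z + real n) (z' + real n) = G2 (z + z' - 1) / (G z * G z')" for z z'
        by (simp add: Q_def G_def G2_def N_def algebra_simps)
      have p1: "N powr \<alpha> * N powr \<beta> = N powr (\<alpha> + \<beta> - 6) * (N powr 3 * N powr 3)"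
        by (simp flip: powr_add)
      have p2: "(2 * N) powr (\<alpha> + \<beta> - 1) = 2 powr (\<alpha> + \<beta> - 6) * N powr (\<alpha> + \<beta> - 6) * (2 * N) powr 5"
      proof -
        have "(2 * N) powr (\<alpha> + \<beta> - 1) = (2 * N) powr (\<alpha> + \<beta> - 6) * (2 * N) powr 5"
          by (simp only: powr_add[symmetric]) simp
        then show ?thesis using f by (simp only: powr_mult)
      qed
      have "v \<alpha> n * v \<beta> n * v 5 (2 * n) / (v (\<alpha> + \<beta> - 1) (2 * n) * v 3 n * v 3 n) * 2 powr (\<alpha> + \<beta> - 6)
        = f * f * (N powr \<alpha> * N powr \<beta>) * (f2 * (2 * N) powr 5 / G2 5) * G2 (\<alpha> + \<beta> - 1) * (G 3 * G 3) * 2 powr (\<alpha> + \<beta> - 6) /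
          (G \<alpha> * G \<beta> * (f2 * (2 * N) powr (\<alpha> + \<beta> - 1)) * (f * f) * (N powr 3 * N powr 3))"
        unfolding vn by (simp add: mult_ac)
      also have "\<dots> = G2 (\<alpha> + \<beta> - 1) / (G \<alpha> * G \<beta>) / (G2 5 / (G 3 * G 3))"
        unfolding p1 p2 using f by simp
      finally show ?case using Qn[of \<alpha> \<beta>] Qn[of 3 3] by simp
    qed
    ultimately show ?thesis by (simp add: tendsto_cong)
  qed
  have "(\<lambda>n. (X \<alpha> \<beta> n / X 3 3 n) / of_real (Q (\<alpha> + real n) (\<beta> + real n) / Q (3 + real n) (3 + real n)))
      \<longlonglongrightarrow> of_real (2 powr (\<alpha> + \<beta> - 6)) / of_real (2 powr (\<alpha> + \<beta> - 6))"
    by (intro tendsto_divide X_ratio tendsto_of_real Q_ratio) auto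
  then have lim1: "(\<lambda>n. (X \<alpha> \<beta> n / X 3 3 n) / of_real (Q (\<alpha> + real n) (\<beta> + real n) / Q (3 + real n) (3 + real n))) \<longlonglongrightarrow> 1"
    by simp
  moreover have "\<forall>\<^sub>F n in sequentially. (X \<alpha> \<beta> n / X 3 3 n) / of_real (Q (\<alpha> + real n) (\<beta> + real n) / Q (3 + real n) (3 + real n))
      = (I \<alpha> \<beta> / of_real (Q \<alpha> \<beta>)) / (I 3 3 / of_real (Q 3 3))"
    using eventually_gt_at_top[of 0]
  proof eventually_elim
    case (elim n)
    have "(X \<alpha> \<beta> n / X 3 3 n) / of_real (Q (\<alpha> + real n) (\<beta> + real n) / Q (3 + real n) (3 + real n))
      = (I (\<alpha> + real n) (\<beta> + real n) / of_real (Q (\<alpha> + real n) (\<beta> + real n))) / (I (3 + real n) (3 + real n) / of_real (Q (3 + real n) (3 + real n)))"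
      using elim by (simp add: X_def)
    then show ?case using inv[OF assms, of n] inv[of 3 3 n] by simp
  qed
  ultimately have "(\<lambda>n::nat. (I \<alpha> \<beta> / of_real (Q \<alpha> \<beta>)) / (I 3 3 / of_real (Q 3 3))) \<longlonglongrightarrow> 1"
    by (rule Lim_transform_eventually)
  then have "(I \<alpha> \<beta> / of_real (Q \<alpha> \<beta>)) / (I 3 3 / of_real (Q 3 3)) = 1"
    by (simp add: LIMSEQ_const_iff)
  moreover have "I 3 3 / of_real (Q 3 3) = of_real (2 * pi)"
  proof -
    have "Q 3 3 = 6" using Gamma_fact[of 4, where 'a = real] Gamma_fact[of 2, where 'a = real]
      by (simp add: Q_def fact_numeral)
    then show ?thesis unfolding I_def beta_line_3_3 by simp
  qed
  ultimately have "I \<alpha> \<beta> / of_real (Q \<alpha> \<beta>) = of_real (2 * pi)"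
    by (simp add: divide_eq_1_iff)
  then have "I \<alpha> \<beta> = of_real (2 * pi) * of_real (Q \<alpha> \<beta>)"
    using Q_pos[OF assms] by (simp add: field_simps)
  then show ?thesis by (simp add: I_def Q_def)
qed

text \<open>For \<open>\<alpha> = 0\<close> the right-hand side is 0, since \<open>Gamma 0 = 0\<close> and division by 0 gives 0.\<close>
lemma beta_line_eq:
  assumes a: "0 < a" "a < 1" and "\<alpha> \<ge> 0" "\<beta> \<ge> 3"
  shows "beta_line a \<alpha> \<beta> = of_real (2 * pi * Gamma (\<alpha> + \<beta> - 1) / (Gamma \<alpha> * Gamma \<beta>))"
proof (cases "\<alpha> = 0")
  case True
  \<comment> \<open>At \<alpha> = 0 the relation reads 0 = (\<beta> - 1) *
    \<open>beta_line a 0 \<beta>\<close>, so the integral vanishes. This case is the constant term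
    of the exponential series.\<close>
  then show ?thesis using beta_line_shift_exponent[OF a, of 0 "\<beta> - 1"] assms by simp
next
  case False
  have "beta_line a \<alpha> \<beta> = beta_line (1 / 2) \<alpha> \<beta>"
    using beta_line_shift_abscissa[of a "1 / 2" \<alpha> \<beta>] beta_line_shift_abscissa[of "1 / 2" a \<alpha> \<beta>] assms
    by (cases "a \<le> 1 / 2") auto
  then show ?thesis using beta_line_half[of \<alpha> \<beta>] False assms by simp
qed

section \<open>The Wright function\<close>

text \<open>Summation and integration may be exchanged because |w| >= c on the line: the terms are
  dominated by an exponential series in |x| c powr (-\<rho>) times one integrable function of y.
  With \<beta> = k + 1 the condition k >= 2 is the range \<beta> >= 3 of
  \<open>beta_line_eq\<close>.\<close>

lemma wright_psi_eq_integral: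
  assumes a: "0 < a" "a < 1" and \<rho>: "\<rho> > 0" and k: "k \<ge> 2"
  shows "wright_psi \<rho> k x = Gamma (k + 1) / (2 * pi) *
    Re (\<integral>y. exp (of_real x * Complex a y powr (- of_real \<rho>)) * (1 - Complex a y) powr (- of_real (k + 1)) \<partial>lborel)"
    (is "_ = _ * Re (integral\<^sup>L lborel ?h)")
proof -
  define c where "c = min a (1 - a)"
  have c: "0 < c" "c \<le> a" "c \<le> 1 - a" using a by (auto simp: c_def)
  define f where "f = (\<lambda>n y. of_real (x ^ n / fact n) * beta_kernel (\<rho> * real n) (k + 1) (Complex a y))"
  define r where "r = (\<lambda>n. Gamma (k + \<rho> * real n) / Gamma (\<rho> * real n) * (x ^ n / fact n))"
  define M where "M = (\<lambda>n. \<bar>x\<bar> ^ n / fact n * c powr (- (\<rho> * real n) - (k + 1)))"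
  define q where "q = (\<lambda>y. inverse (1 + y\<^sup>2 / c\<^sup>2))"
  have q: "integrable lborel q" unfolding q_def by (rule integrable_inverse_one_plus_square_scaled) (rule c)
  have q0: "q y \<ge> 0" for y by (simp add: q_def add_nonneg_nonneg)
  have "M n = c powr (- (k + 1)) * ((\<bar>x\<bar> * c powr (- \<rho>)) ^ n /\<^sub>R fact n)" for n
  proof -
    have "- (\<rho> * real n) - (k + 1) = - \<rho> * real n + - (k + 1)" by simp
    then have "c powr (- (\<rho> * real n) - (k + 1)) = c powr (- \<rho> * real n) * c powr (- (k + 1))"
      by (simp only: powr_add)
    also have "c powr (- \<rho> * real n) = (c powr (- \<rho>)) ^ n"
      using c by (simp only: powr_powr[symmetric]) (simp add: powr_realpow)
    finally show ?thesis by (simp add: M_def power_mult_distrib field_simps)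
  qed
  then have "M = (\<lambda>n. c powr (- (k + 1)) * ((\<bar>x\<bar> * c powr (- \<rho>)) ^ n /\<^sub>R fact n))" by (rule ext)
  then have M: "summable M" by (simp only: summable_mult summable_exp_generic)
  have f_int: "integrable lborel (f n)" for n
    unfolding f_def using a \<rho> k by (intro integrable_mult_right integrable_beta_kernel) auto
  have f_le: "norm (f n y) \<le> M n * q y" for n y
  proof -
    have "cmod (beta_kernel (\<rho> * real n) (k + 1) (Complex a y)) \<le> c powr (- (\<rho> * real n) - (k + 1)) * q y"
      unfolding q_def using c \<rho> k by (intro norm_beta_kernel_le) auto
    then have "\<bar>x ^ n / fact n\<bar> * cmod (beta_kernel (\<rho> * real n) (k + 1) (Complex a y))
        \<le> \<bar>x ^ n / fact n\<bar> * (c powr (- (\<rho> * real n) - (k + 1)) * q y)"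
      by (intro mult_left_mono) auto
    then show ?thesis by (simp add: f_def M_def norm_mult norm_divide norm_power power_abs mult.assoc)
  qed
  have "(\<lambda>n. integral\<^sup>L lborel (f n)) sums (\<integral>y. (\<Sum>n. f n y) \<partial>lborel)"
  proof (rule sums_integral[OF f_int])
    have "summable (\<lambda>n. norm (f n y))" for y
      by (rule summable_comparison_test'[OF summable_mult2[OF M, of "q y"], of 0]) (use f_le in auto)
    then show "AE y in lborel. summable (\<lambda>n. norm (f n y))" by simp
    have "(\<integral>y. norm (f n y) \<partial>lborel) \<le> M n * integral\<^sup>L lborel q" for n
    proof -
      have "(\<integral>y. norm (f n y) \<partial>lborel) \<le> (\<integral>y. M n * q y \<partial>lborel)"
        using f_int q f_le by (intro integral_mono integrable_norm integrable_mult_right) auto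
      then show ?thesis by simp
    qed
    then show "summable (\<lambda>n. \<integral>y. norm (f n y) \<partial>lborel)"
      by (intro summable_comparison_test'[OF summable_mult2[OF M, of "integral\<^sup>L lborel q"], of 0]) auto
  qed
  also have "(\<lambda>y. \<Sum>n. f n y) = ?h"
  proof
    fix y
    let ?w = "Complex a y"
    have w: "?w \<noteq> 0" using a by (auto simp: complex_eq_iff)
    have "f n y = (of_real x * ?w powr (- of_real \<rho>)) ^ n /\<^sub>R fact n * (1 - ?w) powr (- of_real (k + 1))" for n
    proof -
      have "?w powr (- of_real (\<rho> * real n)) = (?w powr (- of_real \<rho>)) ^ n"
        using w by (simp add: powr_def exp_of_nat_mult[symmetric] mult_ac)
      then show ?thesis
        by (simp add: f_def beta_kernel_def power_mult_distrib scaleR_conv_of_real field_simps)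
    qed
    then have "(\<lambda>n. f n y) sums ?h y"
      by (simp only: sums_mult2[OF exp_converges])
    then show "(\<Sum>n. f n y) = ?h y" by (rule sums_unique[symmetric])
  qed
  also have "(\<lambda>n. integral\<^sup>L lborel (f n)) = (\<lambda>n. of_real (2 * pi / Gamma (k + 1) * r n))"
  proof
    fix n
    have "integral\<^sup>L lborel (f n) = of_real (x ^ n / fact n) * beta_line a (\<rho> * real n) (k + 1)"
      by (simp add: f_def beta_line_def)
    also have "\<dots> = of_real (2 * pi / Gamma (k + 1) * r n)"
      using \<rho> k by (subst beta_line_eq[OF a]) (simp_all add: r_def add.commute mult_ac)
    finally show "integral\<^sup>L lborel (f n) = of_real (2 * pi / Gamma (k + 1) * r n)" .
  qed
  finally have "(\<lambda>n. 2 * pi / Gamma (k + 1) * r n) sums Re (integral\<^sup>L lborel ?h)"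
    using sums_Re by fastforce
  then have "(\<lambda>n. Gamma (k + 1) / (2 * pi) * (2 * pi / Gamma (k + 1) * r n)) sums
      (Gamma (k + 1) / (2 * pi) * Re (integral\<^sup>L lborel ?h))"
    by (rule sums_mult)
  moreover have "Gamma (k + 1) > 0" using k by (intro Gamma_real_pos) auto
  ultimately have "r sums (Gamma (k + 1) / (2 * pi) * Re (integral\<^sup>L lborel ?h))" by simp
  \<comment> \<open>\<open>Gamma 0 = 0\<close> and division by 0 gives 0, so the term n = 0 of the
    full exponential series drops out and the shifted sum of \<open>wright_psi\<close>
    remains.\<close>
  moreover have "r 0 = 0" by (simp add: r_def)
  ultimately have "(\<lambda>n. r (Suc n)) sums (Gamma (k + 1) / (2 * pi) * Re (integral\<^sup>L lborel ?h))"
    by (simp add: sums_Suc_iff)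
  then show ?thesis unfolding wright_psi_def r_def by (rule sums_unique[symmetric])
qed

theorem mainTheorem6:
  fixes \<rho> u :: real
  assumes "\<rho> > 0" and "u > 0"
  shows "\<exists>E :: real \<Rightarrow> real.
    E \<in> O[at_top](\<lambda>k. 1 / k) \<and>
    (\<forall>k>0. wright_psi \<rho> k (k * u) =
       Gamma k * sqrt (k / (2 * pi * (1 + \<rho>))) *
       (saddle \<rho> u - \<rho> / (1 + \<rho>)) powr (- 1 / 2) *
       exp (k * saddle_exponent \<rho> (saddle \<rho> u)) * (1 + E k))"
proof -
  define t where "t = saddle \<rho> u"
  have "1 < t \<and> t powr \<rho> * (t - 1) = 1 / (\<rho> * u)"
    unfolding t_def saddle_def using theI'[OF saddle_ex1[OF assms]] .
  then have t: "t > 1" and saddle_eq: "t powr \<rho> * (t - 1) = 1 / (\<rho> * u)" by auto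
  \<comment> \<open>The form of the saddle equation used below: it is the vanishing of the
    derivative of the phase at 1 / t, and it eliminates u from all later formulas.\<close>
  have t\<rho>: "\<rho> * (u * t powr \<rho>) = 1 / (t - 1)"
    using saddle_eq t assms by (simp add: field_simps)
  define \<tau> where "\<tau> = 1 / t"
  have \<tau>: "0 < \<tau>" "\<tau> < 1" using t by (auto simp: \<tau>_def)
  \<comment> \<open>D = (1 + \<rho>) (t - \<rho> / (1 + \<rho>)) carries the last algebraic factor
    of the expansion. It equals V b^2 for the second derivative V of the phase, so D >= 1 is
    precisely the curvature condition of the Laplace estimate.\<close>
  define D where "D = (1 + \<rho>) * t - \<rho>"
  have D: "D \<ge> 1"
  proof -
    have "D - 1 = (1 + \<rho>) * (t - 1)" by (simp add: D_def algebra_simps)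
    then show ?thesis using t assms by (smt (verit) mult_pos_pos)
  qed
  \<comment> \<open>The distance from the saddle point to the singularity 1, hence |1 - w| = b sqrt
    (1 + y^2 / b^2) on the line.\<close>
  define b where "b = 1 - \<tau>"
  define V where "V = D / b\<^sup>2"
  have b: "b > 0" "b = (t - 1) / t" using \<tau> t by (auto simp: b_def \<tau>_def field_simps)
  define \<psi> where "\<psi> = saddle_exponent \<rho> t"
  define \<Phi> :: "complex \<Rightarrow> complex" where "\<Phi> = (\<lambda>w. of_real u * w powr (- of_real \<rho>) - Ln (1 - w))"
  define \<Phi>' :: "complex \<Rightarrow> complex" where "\<Phi>' = (\<lambda>w. - of_real (\<rho> * u) * w powr (- of_real \<rho> - 1) + inverse (1 - w))"
  define g :: "complex \<Rightarrow> complex" where "g = (\<lambda>w. inverse (1 - w))"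
  have line: "Complex \<tau> y \<in> strip" for y using \<tau> by (rule Complex_in_strip)
  have \<tau>S: "of_real \<tau> \<in> strip" using \<tau> by (simp add: strip_def)
  have \<tau>_powr: "complex_of_real \<tau> powr (- of_real s) = of_real (t powr s)" for s
    using t powr_of_real[of \<tau> "- s"] by (simp add: \<tau>_def powr_divide powr_minus field_simps)
  have \<Phi>_deriv: "(\<Phi> has_field_derivative \<Phi>' w) (at w)" if "w \<in> strip" for w
    unfolding \<Phi>_def \<Phi>'_def using strip_nonpos[OF that] strip_nonzero[OF that]
    by (auto intro!: derivative_eq_intros simp: field_simps)
  have \<Phi>'_deriv: "(\<Phi>' has_field_derivative of_real V) (at (of_real \<tau>))"
  proof -
    have "(\<Phi>' has_field_derivative of_real (\<rho> * u) * (of_real \<rho> + 1) * of_real \<tau> powr (- of_real \<rho> - 2) + inverse (1 - of_real \<tau>) * inverse (1 - of_real \<tau>))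
        (at (of_real \<tau>))"
      unfolding \<Phi>'_def using strip_nonpos[OF \<tau>S] strip_nonzero[OF \<tau>S]
      by (auto intro!: derivative_eq_intros simp: algebra_simps)
    also have "complex_of_real \<tau> powr (- of_real \<rho> - 2) = of_real (t powr \<rho> * t\<^sup>2)"
      using \<tau>_powr[of "\<rho> + 2"] t by (simp add: powr_add powr_numeral)
    also have "of_real (\<rho> * u) * (of_real \<rho> + 1) * of_real (t powr \<rho> * t\<^sup>2) + inverse (1 - of_real \<tau>) * inverse (1 - of_real \<tau>)
        = complex_of_real (\<rho> * (u * t powr \<rho>) * (\<rho> + 1) * t\<^sup>2 + inverse (b\<^sup>2))"
      by (simp add: b_def power2_eq_square)
    also have "\<rho> * (u * t powr \<rho>) * (\<rho> + 1) * t\<^sup>2 + inverse (b\<^sup>2) = V"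
      unfolding t\<rho> V_def b D_def using t by (simp add: power_divide divide_simps) (simp add: algebra_simps power2_eq_square)
    finally show ?thesis .
  qed
  note d = deriv_deriv_eq[OF open_strip \<tau>S \<Phi>_deriv \<Phi>'_deriv]
  have \<Phi>_\<tau>: "\<Phi> (of_real \<tau>) = of_real \<psi>"
  proof -
    have "Ln (1 - of_real \<tau>) = of_real (ln b)"
      using Ln_of_real[of b] b by (simp add: b_def)
    then have "\<Phi> (of_real \<tau>) = of_real (u * t powr \<rho> - ln b)"
      by (simp add: \<Phi>_def \<tau>_powr)
    also have "u * t powr \<rho> - ln b = \<psi>"
    proof -
      have "u * t powr \<rho> = 1 / (\<rho> * (t - 1))" using t\<rho> assms t by (simp add: field_simps)
      also have "\<dots> = \<tau> / (\<rho> * b)" using b t by (simp add: \<tau>_def)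
      finally show ?thesis by (simp add: \<psi>_def saddle_exponent_def Let_def \<tau>_def b_def)
    qed
    finally show ?thesis .
  qed
  define J where "J = (\<lambda>k. \<integral>y. exp (of_real k * (\<Phi> (Complex \<tau> y) - \<Phi> (of_real \<tau>))) * g (Complex \<tau> y) \<partial>lborel)"
  define L where "L = sqrt (2 * pi / D)"
  have L: "L > 0" using D by (simp add: L_def)
  have norm_line: "cmod (1 - Complex \<tau> y) = b * sqrt (1 + y\<^sup>2 / b\<^sup>2)" for y
  proof -
    have "cmod (1 - Complex \<tau> y) = sqrt (b\<^sup>2 * (1 + y\<^sup>2 / b\<^sup>2))"
      using b(1) by (simp add: cmod_def b_def[symmetric] distrib_left)
    then show ?thesis using b(1) by (simp add: real_sqrt_mult)
  qed
  have "\<exists>C. \<forall>k\<ge>8. cmod (of_real (sqrt k) * J k - g (of_real \<tau>) * of_real (sqrt (2 * pi / V))) \<le> C / k"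
    unfolding J_def
  proof (rule laplace_vertical[OF open_strip line, where b = b and B = "1 / b"])
    show "\<Phi> holomorphic_on strip" using \<Phi>_deriv open_strip by (meson holomorphic_on_open)
    show "g holomorphic_on strip"
      unfolding g_def using strip_nonzero by (intro holomorphic_intros) auto
    have "complex_of_real \<tau> powr (- of_real \<rho> - 1) = of_real (t powr \<rho> * t)"
      using \<tau>_powr[of "\<rho> + 1"] t by (simp add: powr_add)
    then have "\<Phi>' (of_real \<tau>) = of_real (- (\<rho> * (u * t powr \<rho>)) * t + inverse b)"
      by (simp add: \<Phi>'_def b_def)
    also have "- (\<rho> * (u * t powr \<rho>)) * t + inverse b = 0"
      unfolding t\<rho> b using t by simp
    finally show "deriv \<Phi> (of_real \<tau>) = 0" using d(1) by simp
    show "deriv (deriv \<Phi>) (of_real \<tau>) = of_real V" by (rule d(2))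
    show "1 \<le> V * b\<^sup>2" using D b(1) by (simp add: V_def)
    show "Re (\<Phi> (Complex \<tau> y)) \<le> Re (\<Phi> (of_real \<tau>)) - ln (1 + y\<^sup>2 / b\<^sup>2) / 2" for y
    proof -
      \<comment> \<open>The two terms of the phase are treated separately. The real part of u w powr
        (-\<rho>) is at most its modulus, which is largest at y = 0 since |w| >= \<tau>; the whole
        required drop comes from -log |1 - w|.\<close>
      have "Re (of_real u * Complex \<tau> y powr (- of_real \<rho>)) \<le> u * cmod (Complex \<tau> y powr (- of_real \<rho>))"
        using assms complex_Re_le_cmod by simp
      also have "cmod (Complex \<tau> y powr (- of_real \<rho>)) = cmod (Complex \<tau> y) powr (- \<rho>)"
        by (simp add: norm_powr_real_powr')
      also have "\<dots> \<le> \<tau> powr (- \<rho>)"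
        using \<tau> assms abs_Re_le_cmod[of "Complex \<tau> y"] by (intro powr_mono2') auto
      finally have 1: "Re (of_real u * Complex \<tau> y powr (- of_real \<rho>)) \<le> u * \<tau> powr (- \<rho>)"
        using assms by simp
      have "1 + y\<^sup>2 / b\<^sup>2 > 0" by (simp add: add_pos_nonneg)
      then have 2: "Re (Ln (1 - Complex \<tau> y)) = ln b + ln (1 + y\<^sup>2 / b\<^sup>2) / 2"
        using strip_nonzero[OF line[of y]] b(1) by (simp add: norm_line ln_mult ln_sqrt)
      have "Re (\<Phi> (of_real \<tau>)) = u * \<tau> powr (- \<rho>) - ln b"
        using \<tau> b(1) Ln_of_real[of b] powr_of_real[of \<tau> "- \<rho>"] by (simp add: \<Phi>_def b_def)
      then show ?thesis using 1 2 by (simp add: \<Phi>_def)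
    qed
    show "cmod (g (Complex \<tau> y)) \<le> 1 / b" for y
    proof -
      have "b \<le> cmod (1 - Complex \<tau> y)"
        using abs_Re_le_cmod[of "1 - Complex \<tau> y"] b(1) by (simp add: b_def)
      then have "inverse (cmod (1 - Complex \<tau> y)) \<le> inverse b" using b(1) by (rule le_imp_inverse_le)
      then show ?thesis by (simp only: g_def norm_inverse inverse_eq_divide[of b, symmetric])
    qed
  qed (rule b)
  then obtain C where C: "\<And>k. k \<ge> 8 \<Longrightarrow> cmod (of_real (sqrt k) * J k - g (of_real \<tau>) * of_real (sqrt (2 * pi / V))) \<le> C / k"
    by blast
  \<comment> \<open>The amplitude 1 / b at the saddle point cancels the factor b in sqrt (2 pi / V),
    which leaves a constant depending on \<open>D\<close> only.\<close>
  have gL: "g (of_real \<tau>) * of_real (sqrt (2 * pi / V)) = of_real L"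
  proof -
    have "sqrt (2 * pi / V) = L * b"
      using b(1) by (simp add: V_def L_def real_sqrt_divide real_sqrt_mult)
    moreover have "g (of_real \<tau>) = of_real (inverse b)" by (simp add: g_def b_def)
    ultimately show ?thesis using b(1) by simp
  qed
  have psi_J: "wright_psi \<rho> k (k * u) = Gamma (k + 1) / (2 * pi) * exp (k * \<psi>) * Re (J k)" if k: "k \<ge> 8" for k
  proof -
    have "exp (of_real (k * u) * w powr (- of_real \<rho>)) * (1 - w) powr (- of_real (k + 1))
        = of_real (exp (k * \<psi>)) * (exp (of_real k * (\<Phi> w - \<Phi> (of_real \<tau>))) * g w)" if w: "w \<in> strip" for w
    proof -
      \<comment> \<open>The extra power beyond k becomes the amplitude g, so that k multiplies the
        phase exactly.\<close>
      have "(1 - w) powr (- of_real (k + 1)) = exp (- of_real k * Ln (1 - w)) * g w"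
      proof -
        have "(1 - w) powr (- of_real (k + 1)) = exp (- of_real k * Ln (1 - w) + - Ln (1 - w))"
          using strip_nonzero[OF w] by (simp add: powr_def algebra_simps)
        also have "\<dots> = exp (- of_real k * Ln (1 - w)) * g w"
          unfolding exp_add using strip_nonzero[OF w] by (simp add: exp_minus g_def)
        finally show ?thesis .
      qed
      moreover have "of_real (exp (k * \<psi>)) = exp (of_real k * \<Phi> (of_real \<tau>))"
        by (simp add: \<Phi>_\<tau> flip: exp_of_real)
      moreover have "exp (of_real k * \<Phi> (of_real \<tau>)) * exp (of_real k * (\<Phi> w - \<Phi> (of_real \<tau>)))
          = exp (of_real (k * u) * w powr (- of_real \<rho>)) * exp (- of_real k * Ln (1 - w))"
        unfolding exp_add[symmetric] by (simp add: \<Phi>_def algebra_simps)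
      ultimately show ?thesis by (simp add: mult.assoc[symmetric])
    qed
    then show ?thesis
      using k by (simp add: wright_psi_eq_integral[OF \<tau> assms(1)] line J_def del: of_real_add of_real_mult)
  qed
  define P where "P = (\<lambda>k. Gamma k * sqrt (k / (2 * pi * (1 + \<rho>))) * (t - \<rho> / (1 + \<rho>)) powr (- 1 / 2) * exp (k * \<psi>))"
  have P: "P k = Gamma k * exp (k * \<psi>) * (sqrt k * L / (2 * pi))" if "k > 0" for k
  proof -
    have "t - \<rho> / (1 + \<rho>) = D / (1 + \<rho>)" using assms by (simp add: D_def field_simps)
    then have "(t - \<rho> / (1 + \<rho>)) powr (- 1 / 2) = inverse (sqrt (D / (1 + \<rho>)))"
      using D assms by (simp add: powr_minus powr_half_sqrt)
    then have 1: "(t - \<rho> / (1 + \<rho>)) powr (- 1 / 2) = sqrt (1 + \<rho>) / sqrt D"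
      by (simp add: real_sqrt_divide)
    have 2: "sqrt (k / (2 * pi * (1 + \<rho>))) = sqrt k / (sqrt (2 * pi) * sqrt (1 + \<rho>))"
      by (simp only: real_sqrt_divide real_sqrt_mult)
    have 3: "L = sqrt (2 * pi) / sqrt D" by (simp only: L_def real_sqrt_divide)
    have 4: "2 * pi = sqrt (2 * pi) * sqrt (2 * pi)" by simp
    define x y z where "x = sqrt (2 * pi)" and "y = sqrt (1 + \<rho>)" and "z = sqrt D"
    have nz: "x > 0" "y > 0" "z > 0" using assms D by (auto simp: x_def y_def z_def)
    have "P k = Gamma k * (sqrt k / (x * y)) * (y / z) * exp (k * \<psi>)"
      by (simp only: P_def 1 2 x_def y_def z_def)
    also have "\<dots> = Gamma k * exp (k * \<psi>) * (sqrt k * (x / z) / (x * x))"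
      using nz by (simp add: field_simps)
    also have "\<dots> = Gamma k * exp (k * \<psi>) * (sqrt k * L / (2 * pi))"
      unfolding 3 x_def z_def 4[symmetric] ..
    finally show ?thesis .
  qed
  have P0: "P k > 0" if "k > 0" for k
    using that L Gamma_real_pos[OF that] by (simp add: P)
  \<comment> \<open>Taking the exact quotient makes the identity hold for every k > 0, also where
    the integral representation has not been established; only the decay of \<open>E\<close> needs
    large k.\<close>
  define E where "E = (\<lambda>k. wright_psi \<rho> k (k * u) / P k - 1)"
  have "E \<in> O[at_top](\<lambda>k. 1 / k)"
  proof (rule bigoI)
    show "\<forall>\<^sub>F k in at_top. norm (E k) \<le> C / L * norm (1 / k)"
      using eventually_ge_at_top[of 8]
    proof eventually_elim
      case (elim k)
      \<comment> \<open>Of the factor k = sqrt k * sqrt k, one root belongs to the prefactor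
        \<open>P\<close> and the other normalises \<open>J k\<close>.\<close>
      have "Gamma (k + 1) = k * Gamma k" using elim Gamma_plus1[of k] by (auto simp: nonpos_Ints_def)
      moreover have "k = sqrt k * sqrt k" using elim by simp
      ultimately have "wright_psi \<rho> k (k * u) = P k * (sqrt k * Re (J k) / L)"
        using elim L by (simp add: psi_J P)
      then have "E k = (sqrt k * Re (J k) - L) / L"
        using P0[of k] elim L by (simp add: E_def field_simps)
      also have "sqrt k * Re (J k) - L = Re (of_real (sqrt k) * J k - of_real L)" by simp
      finally have "\<bar>E k\<bar> = \<bar>Re (of_real (sqrt k) * J k - of_real L)\<bar> / L" using L by simp
      also have "\<dots> \<le> (C / k) / L"
        using C[OF elim] L abs_Re_le_cmod[of "of_real (sqrt k) * J k - of_real L"]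
        unfolding gL by (intro divide_right_mono) auto
      finally show ?case using elim by (simp add: mult.commute)
    qed
  qed
  moreover have "\<forall>k>0. wright_psi \<rho> k (k * u) = P k * (1 + E k)"
    using P0 by (simp add: E_def less_imp_neq[symmetric])
  ultimately show ?thesis unfolding P_def \<psi>_def t_def by blast
qed

end
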